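(* Let $\mathcal{O}=\{t_1,\dots,t_\mu\}$ be an order ideal in $\mathbb{T}^n$. (a) Let $\mathcal{H}$ be an $(n,\mu)$-admissible affine Hilbert function with $\mathrm{HF}^{(n,\mu)}\succeq\mathcal{H}\succeq\mathrm{HF}^a_{\mathcal{O}}$. Then $\mathbb{B}_{\mathcal{O}}(\mathcal{H})$ is an open subscheme of $\mathbb{B}_{\mathcal{O}}(\overline{\mathcal{H}})$ and a locally closed subscheme of $\mathbb{B}_{\mathcal{O}}$. (It is called the $\mathcal{H}$-Hilbert stratum of $\mathbb{B}_{\mathcal{O}}$.) (b) Let $\mathbb{H}_{\mathcal{O}}$ be the set of all $(n,\mu)$-admissible affine Hilbert functions $\mathcal{H}$ with $\mathrm{HF}^{(n,\mu)}\succeq\mathcal{H}\succeq\mathrm{HF}^a_{\mathcal{O}}$. Then we have a disjoint union $\mathbb{B}_{\mathcal{O}}=\bigcup_{\mathcal{H}\in\mathbb{H}_{\mathcal{O}}}\mathbb{B}_{\mathcal{O}}(\mathcal{H})$. (It is called the Hilbert stratification of $\mathbb{B}_{\mathcal{O}}$.)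
   Context: $K$ is an arbitrary field, $P=K[x_1,\dots,x_n]$, and $\mathbb{T}^n$ is the monoid of terms (power products) in $x_1,\dots,x_n$. An order ideal is a finite set $\mathcal{O}=\{t_1,\dots,t_\mu\}\subset\mathbb{T}^n$ with $\mu\ge 1$ containing every divisor in $\mathbb{T}^n$ of each of its elements; it is always ordered so that $\deg(t_1)\le\cdots\le\deg(t_\mu)$, hence $t_1=1$. Its border is $\partial\mathcal{O}=(x_1\mathcal{O}\cup\cdots\cup x_n\mathcal{O})\setminus\mathcal{O}=\{b_1,\dots,b_\nu\}$, and its affine Hilbert function is $\mathrm{HF}^a_{\mathcal{O}}(i)=\#\{j\mid\deg(t_j)\le i\}$. Let $C=\{c_{ij}\mid 1\le i\le\mu,\ 1\le j\le\nu\}$ be new indeterminates. The $r$-th generic multiplication matrix $\mathcal{A}_r=(a^{(r)}_{ij})\in\mathrm{Mat}_\mu(K[C])$ has $a^{(r)}_{ij}=\delta_{im}$ if $x_rt_j=t_m$ and $a^{(r)}_{ij}=c_{im}$ if $x_rt_j=b_m$. $I(\mathbb{B}_{\mathcal{O}})\subseteq K[C]$ is generated by the entries of all commutators $\mathcal{A}_r\mathcal{A}_s-\mathcal{A}_s\mathcal{A}_r$, and the border basis scheme $\mathbb{B}_{\mathcal{O}}\subseteq\mathrm{Spec}(K[C])$ is the closed subscheme it defines. For a $K$-rational point $\Gamma=(\gamma_{ij})$ of $\mathbb{B}_{\mathcal{O}}$, let $R_\Gamma=P/I_\Gamma$ where $I_\Gamma$ is generated by $b_j-\sum_i\gamma_{ij}t_i$.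 For a 0-dimensional $\mathbb{X}\subset\mathbb{A}^n_K$ with coordinate ring $R_{\mathbb{X}}=P/I_{\mathbb{X}}$, the affine Hilbert function $\mathrm{HF}^a_{\mathbb{X}}(i)=\mathrm{HF}^a_{R_{\mathbb{X}}}(i)$ is the $K$-dimension of the image in $R_{\mathbb{X}}$ of the polynomials of degree $\le i$. For sequences of non-negative integers, $(H_i)_{i\ge 0}\succeq(H'_i)_{i\ge 0}$ ("dominates") means $H_i\ge H'_i$ for all $i$. A sequence $\mathcal{H}$ is $(n,\mu)$-admissible if $\mathcal{H}=\mathrm{HF}^a_{\mathbb{X}}$ for some 0-dimensional subscheme $\mathbb{X}\subset\mathbb{A}^n_K$ of length $\mu=\dim_K(R_{\mathbb{X}})$. $\mathrm{HF}^{(n,\mu)}$ is the sequence with $i$-th entry $\min\{\mu,\#\mathbb{T}^n_{\le i}\}$, where $\mathbb{T}^n_{\le i}$ is the set of terms of degree $\le i$. $\mathbb{B}_{\mathcal{O}}(\overline{\mathcal{H}})$ is the closed subscheme of $\mathbb{B}_{\mathcal{O}}$ which is the closure of the set of $K$-rational points $\Gamma$ for which $\mathrm{HF}^a_{R_\Gamma}$ is dominated by $\mathcal{H}$. $\mathbb{B}_{\mathcal{O}}(\mathcal{H})$ is the complement in $\mathbb{B}_{\mathcal{O}}(\overline{\mathcal{H}})$ of the closure of the set of $K$-rational points $\Gamma$ for which $\mathrm{HF}^a_{R_\Gamma}$ is strictly dominated by $\mathcal{H}$ (i.e. dominated by and different from $\mathcal{H}$). Conventions: $K$-rational points are to be read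 as $L$-rational points over field extensions $L\supseteq K$, e.g. $L=\overline{K}$ (in particular the closures above are formed using $\overline{K}$-rational points); subschemes are considered up to radical of the defining ideals, so the union in (b) is one of underlying sets. *)

theory Defs
  imports
    "HOL-Analysis.Analysis"
    "HOL-Library.Poly_Mapping"
    "HOL-Algebra.Algebraic_Closure_Type"
    "HOL-Algebra.Embedded_Algebras"
    "HOL-Algebra.QuotRing"
begin

section \<open>Terms, order ideals and polynomials\<close>

text \<open>
  Terms are exponent vectors written additively, so that the product of two terms is their sum
  and \<open>1\<close> is the zero vector. The indeterminates are the elements of a (finite) type.
\<close>

type_synonym 'x pterm = "'x \<Rightarrow>\<^sub>0 nat"
type_synonym ('x, 'a) mpoly = "'x pterm \<Rightarrow>\<^sub>0 'a"

definition var_term :: "'x \<Rightarrow> 'x pterm"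
  where "var_term x = Poly_Mapping.single x 1"

definition tdeg :: "'x pterm \<Rightarrow> nat"
  where "tdeg s = (\<Sum>x\<in>Poly_Mapping.keys s. Poly_Mapping.lookup s x)"

definition order_ideal :: "'x pterm set \<Rightarrow> bool"
  where "order_ideal \<O> \<longleftrightarrow> finite \<O> \<and> \<O> \<noteq> {} \<and> (\<forall>u v. u + v \<in> \<O> \<longrightarrow> u \<in> \<O>)"

definition border :: "'x pterm set \<Rightarrow> 'x pterm set"
  where "border \<O> = (\<Union>x. (\<lambda>s. var_term x + s) ` \<O>) - \<O>"

abbreviation mpoly_ring :: "('x, 'a::comm_ring_1) mpoly ring"
  where "mpoly_ring \<equiv> ring_of_type_algebra"

definition mpoly_const :: "'a::zero \<Rightarrow> ('x, 'a) mpoly"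
  where "mpoly_const c = Poly_Mapping.single 0 c"

definition mpoly_var :: "'x \<Rightarrow> ('x, 'a::zero_neq_one) mpoly"
  where "mpoly_var x = Poly_Mapping.single (var_term x) 1"

definition mpolys_upto :: "nat \<Rightarrow> ('x, 'a::zero) mpoly set"
  where "mpolys_upto i = {f. \<forall>s\<in>Poly_Mapping.keys f. tdeg s \<le> i}"


section \<open>Affine Hilbert functions\<close>

text \<open>
  The image of \<open>K\<close> in \<open>P/I\<close>; it is a copy of the field \<open>K\<close> whenever \<open>I\<close> is a proper ideal, and
  \<open>K\<close>-dimensions in \<open>P/I\<close> are taken with respect to it.
\<close>

definition quot_consts :: "('x, 'a::field) mpoly set \<Rightarrow> ('x, 'a) mpoly set set"
  where "quot_consts I = (\<lambda>c. I +>\<^bsub>mpoly_ring\<^esub> mpoly_const c) ` UNIV"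

definition affine_HF :: "('x, 'a::field) mpoly set \<Rightarrow> nat \<Rightarrow> nat"
  where "affine_HF I i =
    ring.dim (mpoly_ring Quot I) (quot_consts I) ((\<lambda>f. I +>\<^bsub>mpoly_ring\<^esub> f) ` mpolys_upto i)"

definition order_ideal_HF :: "'x pterm set \<Rightarrow> nat \<Rightarrow> nat"
  where "order_ideal_HF \<O> i = card {s \<in> \<O>. tdeg s \<le> i}"

definition max_HF :: "'n::finite itself \<Rightarrow> nat \<Rightarrow> nat \<Rightarrow> nat"
  where "max_HF _ \<mu> i = min \<mu> (card {s :: 'n pterm. tdeg s \<le> i})"

text \<open>
  A closed subscheme of affine \<open>n\<close>-space is given by an ideal \<open>I\<close> of \<open>P\<close>; for \<open>\<mu> \<ge> 1\<close> it is
  0-dimensional of length \<open>\<mu>\<close> iff \<open>P/I\<close> has \<open>K\<close>-dimension \<open>\<mu>\<close>.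
\<close>

definition admissible :: "'k::field itself \<Rightarrow> 'n::finite itself \<Rightarrow> nat \<Rightarrow> (nat \<Rightarrow> nat) \<Rightarrow> bool"
  where "admissible _ _ \<mu> H \<longleftrightarrow>
    (\<exists>I :: ('n, 'k) mpoly set. ideal I mpoly_ring \<and>
       ring.dimension (mpoly_ring Quot I) \<mu> (quot_consts I) (carrier (mpoly_ring Quot I)) \<and>
       H = affine_HF I)"


section \<open>The Zariski topology\<close>

definition prime_spec :: "('x, 'k::field) mpoly set set"
  where "prime_spec = {p. primeideal p mpoly_ring}"

definition zero_locus :: "('x, 'k::field) mpoly set \<Rightarrow> ('x, 'k) mpoly set set"
  where "zero_locus E = {p \<in> prime_spec. E \<subseteq> p}"

definition zariski :: "('x, 'k::field) mpoly set topology"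
  where "zariski = topology (\<lambda>U. \<exists>E. U = prime_spec - zero_locus E)"

lemma openin_zariski:
  fixes U :: "('x, 'k::field) mpoly set set"
  shows "openin zariski U \<longleftrightarrow> (\<exists>E. U = prime_spec - zero_locus E)"
proof -
  let ?op = "\<lambda>U :: ('x, 'k) mpoly set set. \<exists>E. U = prime_spec - zero_locus E"
  have inter: "?op (S \<inter> T)" if ST: "?op S" "?op T" for S T
  proof -
    obtain E F where E: "S = prime_spec - zero_locus E" and F: "T = prime_spec - zero_locus F"
      using ST by blast
    let ?G = "{f * g | f g. f \<in> E \<and> g \<in> F}"
    have "E \<subseteq> p \<or> F \<subseteq> p" if p: "primeideal p mpoly_ring" and sub: "?G \<subseteq> p" for p
    proof (rule ccontr)
      assume "\<not> (E \<subseteq> p \<or> F \<subseteq> p)"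
      then obtain f g where fg: "f \<in> E" "g \<in> F" "f \<notin> p" "g \<notin> p" by auto
      then have "f * g \<in> p" using sub by auto
      then show False
        using primeideal.I_prime[OF p, of f g] fg by (simp add: ring_of_type_algebra_def)
    qed
    moreover have "f * g \<in> p" if p: "primeideal p mpoly_ring" and "f \<in> p \<or> g \<in> p" for p f g
    proof -
      interpret primeideal p mpoly_ring by (rule p)
      show ?thesis
        using that(2) I_l_closed[of g f] I_r_closed[of f g]
        by (auto simp: ring_of_type_algebra_def)
    qed
    ultimately have "S \<inter> T = prime_spec - zero_locus ?G"
      unfolding E F zero_locus_def prime_spec_def by blast
    then show ?thesis by blast
  qed
  have union: "?op (\<Union>\<U>)" if Us: "\<forall>U\<in>\<U>. ?op U" for \<U>
  proof -
    obtain E where E: "\<And>U. U \<in> \<U> \<Longrightarrow> U = prime_spec - zero_locus (E U)"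
      using Us by metis
    have "\<Union>\<U> = prime_spec - zero_locus (\<Union>U\<in>\<U>. E U)" (is "_ = ?R")
    proof (intro Set.set_eqI iffI)
      fix p assume "p \<in> \<Union>\<U>"
      then obtain U where U: "U \<in> \<U>" "p \<in> U" by blast
      then have "p \<in> prime_spec - zero_locus (E U)" using E[OF U(1)] by blast
      then show "p \<in> ?R" using U(1) unfolding zero_locus_def by blast
    next
      fix p assume "p \<in> ?R"
      then obtain U where U: "U \<in> \<U>" "p \<in> prime_spec - zero_locus (E U)"
        unfolding zero_locus_def by blast
      then have "p \<in> U" using E[OF U(1)] by blast
      then show "p \<in> \<Union>\<U>" using U(1) by blast
    qed
    then show ?thesis by blast
  qed
  have "istopology ?op" unfolding istopology_def using inter union by blast
  then show ?thesis unfolding zariski_def by (simp add: topology_inverse')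
qed

definition locally_closedin :: "'a topology \<Rightarrow> 'a set \<Rightarrow> bool"
  where "locally_closedin T S \<longleftrightarrow> (\<exists>U Z. openin T U \<and> closedin T Z \<and> S = U \<inter> Z)"


section \<open>The border basis scheme\<close>

text \<open>
  The families \<open>t\<close> and \<open>b\<close> enumerate the order ideal and its border; the indeterminate
  \<open>c\<^sub>i\<^sub>j\<close> is the variable \<open>(i, j)\<close>.
\<close>

definition gen_mult_matrix ::
  "('m::finite \<Rightarrow> 'n pterm) \<Rightarrow> ('v \<Rightarrow> 'n pterm) \<Rightarrow> 'n \<Rightarrow> ('m \<times> 'v, 'k::field) mpoly ^ 'm ^ 'm"
  where "gen_mult_matrix t b r =
    (\<chi> i j. if var_term r + t j \<in> range t
             then (if var_term r + t j = t i then 1 else 0)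
             else mpoly_var (i, THE m. var_term r + t j = b m))"

definition border_basis_ideal ::
  "('m::finite \<Rightarrow> 'n pterm) \<Rightarrow> ('v \<Rightarrow> 'n pterm) \<Rightarrow> ('m \<times> 'v, 'k::field) mpoly set"
  where "border_basis_ideal t b =
    Idl\<^bsub>mpoly_ring\<^esub> {(gen_mult_matrix t b r ** gen_mult_matrix t b s
                      - gen_mult_matrix t b s ** gen_mult_matrix t b r) $ i $ j | r s i j. True}"

text \<open>
  Subschemes are considered up to radical, so the border basis scheme and its subschemes are
  represented by their underlying spaces: sets of prime ideals with the Zariski topology.
\<close>

definition border_basis_scheme ::
  "'k::field itself \<Rightarrow> ('m::finite \<Rightarrow> 'n pterm) \<Rightarrow> ('v \<Rightarrow> 'n pterm) \<Rightarrow> ('m \<times> 'v, 'k) mpoly set topology"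
  where "border_basis_scheme _ t b = subtopology zariski (zero_locus (border_basis_ideal t b))"

definition eval_ac :: "('x \<Rightarrow> 'k alg_closure) \<Rightarrow> ('x, 'k::field) mpoly \<Rightarrow> 'k alg_closure"
  where "eval_ac \<Gamma> f = (\<Sum>s\<in>Poly_Mapping.keys f.
    to_ac (Poly_Mapping.lookup f s) * (\<Prod>x\<in>Poly_Mapping.keys s. \<Gamma> x ^ Poly_Mapping.lookup s x))"

definition geometric_points ::
  "('m::finite \<Rightarrow> 'n pterm) \<Rightarrow> ('v \<Rightarrow> 'n pterm) \<Rightarrow> ('m \<times> 'v \<Rightarrow> 'k::field alg_closure) set"
  where "geometric_points t b = {\<Gamma>. \<forall>f\<in>border_basis_ideal t b. eval_ac \<Gamma> f = 0}"

definition point_ideal :: "('x \<Rightarrow> 'k::field alg_closure) \<Rightarrow> ('x, 'k) mpoly set"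
  where "point_ideal \<Gamma> = {f. eval_ac \<Gamma> f = 0}"

definition border_basis_fiber_ideal ::
  "('m::finite \<Rightarrow> 'n pterm) \<Rightarrow> ('v \<Rightarrow> 'n pterm) \<Rightarrow> ('m \<times> 'v \<Rightarrow> 'l::field) \<Rightarrow> ('n, 'l) mpoly set"
  where "border_basis_fiber_ideal t b \<Gamma> =
    Idl\<^bsub>mpoly_ring\<^esub> {Poly_Mapping.single (b j) 1
                     - (\<Sum>i\<in>UNIV. mpoly_const (\<Gamma> (i, j)) * Poly_Mapping.single (t i) 1) | j. True}"


section \<open>Hilbert strata\<close>

text \<open>
  Domination of Hilbert functions is the pointwise order on \<^typ>\<open>nat \<Rightarrow> nat\<close>, and strict domination
  its strict part. The closures are taken in the border basis scheme, of the images in the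
  spectrum of points with coordinates in the algebraic closure.
\<close>

definition closed_stratum ::
  "'k::field itself \<Rightarrow> ('m::finite \<Rightarrow> 'n pterm) \<Rightarrow> ('v \<Rightarrow> 'n pterm) \<Rightarrow> (nat \<Rightarrow> nat)
     \<Rightarrow> ('m \<times> 'v, 'k) mpoly set set"
  where "closed_stratum K t b H = border_basis_scheme K t b closure_of
    (point_ideal ` {\<Gamma> \<in> geometric_points t b. affine_HF (border_basis_fiber_ideal t b \<Gamma>) \<le> H})"

definition hilbert_stratum ::
  "'k::field itself \<Rightarrow> ('m::finite \<Rightarrow> 'n pterm) \<Rightarrow> ('v \<Rightarrow> 'n pterm) \<Rightarrow> (nat \<Rightarrow> nat)
     \<Rightarrow> ('m \<times> 'v, 'k) mpoly set set"
  where "hilbert_stratum K t b H = closed_stratum K t b H - border_basis_scheme K t b closure_of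
    (point_ideal ` {\<Gamma> \<in> geometric_points t b. affine_HF (border_basis_fiber_ideal t b \<Gamma>) < H})"

text \<open>The index set of the stratification; \<open>CARD('m)\<close> is \<open>\<mu>\<close>.\<close>

definition stratum_HFs :: "'k::field itself \<Rightarrow> ('m::finite \<Rightarrow> 'n::finite pterm) \<Rightarrow> (nat \<Rightarrow> nat) set"
  where "stratum_HFs K t = {H. admissible K TYPE('n) CARD('m) H \<and>
    order_ideal_HF (range t) \<le> H \<and> H \<le> max_HF TYPE('n) CARD('m)}"

end

theory Submission
  imports Defs
begin

text \<open>
  Part (a) is topology: by definition a Hilbert stratum is a closed subset of the scheme minus another closed
  subset.
  
  For part (b), the closed strata have to be identified with loci of equations. At a geometric point \<open>\<Gamma>\<close> the
  multiplication matrices commute, so polynomials act on column vectors, and applying them to the vector of \<open>1\<close>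
  identifies \<open>R\<^sub>\<Gamma>\<close> with \<open>L^\<mu>\<close>, the order ideal giving the unit vectors
  (\<open>fiber_ideal_eq_kernel\<close>). Hence the affine Hilbert function at \<open>i\<close> is the rank of the vectors of the terms
  of degree at most \<open>i\<close>, whose entries are polynomials in the coordinates of \<open>\<Gamma>\<close>. The condition
  \<open>HF \<le> H\<close> is then the vanishing of certain determinants (\<open>affine_HF_le_iff_rank_equations\<close>).
  
  By the Nullstellensatz, the closure of the geometric points satisfying given equations is the whole locus of these
  equations (\<open>closure_of_geometric_points\<close>). In particular the closed strata of \<open>H\<close> and \<open>H'\<close> meet in the closure of
  the points with \<open>HF \<le> H\<close> and \<open>HF \<le> H'\<close>, and this is the reason why different strata are disjoint. Since only
  finitely many functions \<open>HF\<close> occur at geometric points, the scheme is a finite union of closed strata, and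
  what is removed from a closed stratum is a finite union of smaller ones. A point therefore lies
  in the stratum of any \<open>H\<close> that is minimal among the functions whose closed stratum contains it.
  
  It remains to see that the occurring functions are admissible over \<open>K\<close> itself, although the points are defined over the
  algebraic closure. For a term order refining the degree, the terms that are not leading
  terms of the ideal form a divisor-closed set which has the same Hilbert function, and such a set spans a quotient by a
  monomial ideal over every field (\<open>admissible_affine_HF\<close>).
  
  The Nullstellensatz is proved for prime ideals over an arbitrary field, by extending homomorphisms into an algebraically
  closed field along one generator at a time (\<open>extend_to_simple_extension\<close>).
\<close>

section \<open>Hilbert's Nullstellensatz\<close>

definition polys_over :: "'b::comm_ring_1 set \<Rightarrow> 'b poly set"
  where "polys_over A = {g. \<forall>i. poly.coeff g i \<in> A}"

locale unital_hom =
  fixes \<phi> :: "'b::comm_ring_1 \<Rightarrow> 'c::comm_ring_1"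
  assumes hom_one: "\<phi> 1 = 1"
    and hom_add: "\<And>u v. \<phi> (u + v) = \<phi> u + \<phi> v"
    and hom_mult: "\<And>u v. \<phi> (u * v) = \<phi> u * \<phi> v"
begin

lemma hom_zero: "\<phi> 0 = 0"
  using hom_add[of 0 0] by simp

lemma hom_uminus: "\<phi> (- u) = - \<phi> u"
  using hom_add[of u "- u"] hom_zero by (simp add: minus_unique)

lemma hom_diff: "\<phi> (u - v) = \<phi> u - \<phi> v"
  using hom_add[of u "- v"] hom_uminus by simp

lemma hom_sum: "\<phi> (sum f S) = (\<Sum>i\<in>S. \<phi> (f i))"
  by (induction S rule: infinite_finite_induct) (auto simp: hom_zero hom_add)

lemma hom_prod: "\<phi> (prod f S) = (\<Prod>i\<in>S. \<phi> (f i))"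
  by (induction S rule: infinite_finite_induct) (auto simp: hom_one hom_mult)

lemma hom_power: "\<phi> (u ^ n) = \<phi> u ^ n"
  by (induction n) (auto simp: hom_one hom_mult)

lemma map_poly_add: "map_poly \<phi> (g + h) = map_poly \<phi> g + map_poly \<phi> h"
  by (rule poly_eqI) (simp add: coeff_map_poly hom_zero hom_add)

lemma map_poly_diff: "map_poly \<phi> (g - h) = map_poly \<phi> g - map_poly \<phi> h"
  by (rule poly_eqI) (simp add: coeff_map_poly hom_zero hom_diff)

lemma map_poly_mult: "map_poly \<phi> (g * h) = map_poly \<phi> g * map_poly \<phi> h"
  by (rule poly_eqI) (simp add: coeff_map_poly hom_zero coeff_mult hom_sum hom_mult)

lemma map_poly_smult: "map_poly \<phi> (Polynomial.smult a g) = Polynomial.smult (\<phi> a) (map_poly \<phi> g)"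
  by (rule poly_eqI) (simp add: coeff_map_poly hom_zero hom_mult)

lemma map_poly_zero_if: "(\<And>i. \<phi> (poly.coeff g i) = 0) \<Longrightarrow> map_poly \<phi> g = 0"
  by (rule poly_eqI) (simp add: coeff_map_poly hom_zero)

lemma hom_poly: "\<phi> (poly g x) = poly (map_poly \<phi> g) (\<phi> x)"
  by (induction g) (auto simp: hom_zero hom_add hom_mult map_poly_pCons)

end

lemma exists_non_root:
  fixes f :: "'a::alg_closed_field poly"
  assumes "f \<noteq> 0"
  shows "\<exists>c. poly f c \<noteq> 0"
proof (cases "Polynomial.degree f = 0")
  case True
  then obtain a where "f = [:a:]" by (rule degree_eq_zeroE)
  then show ?thesis using assms by auto
next
  case False
  have "poly.coeff (f - 1) (Polynomial.degree f) \<noteq> 0"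
    using False assms by (simp add: coeff_eq_0)
  then have "Polynomial.degree f \<le> Polynomial.degree (f - 1)" by (rule le_degree)
  then obtain c where "poly (f - 1) c = 0"
    using alg_closed_imp_poly_has_root[of "f - 1"] False by auto
  then show ?thesis by (intro exI[of _ c]) simp
qed

text \<open>
  This locale stands for the domain \<open>A/(A \<inter> p)\<close>. Its elements are handled by representatives and
  congruences modulo \<open>p\<close>, because the quotient is not a type, let alone one with a fraction field.
\<close>

locale prime_and_subring =
  fixes A p :: "'b::comm_ring_1 set"
  assumes A_one: "1 \<in> A" and A_diff: "\<And>u v. u \<in> A \<Longrightarrow> v \<in> A \<Longrightarrow> u - v \<in> A"
    and A_mult: "\<And>u v. u \<in> A \<Longrightarrow> v \<in> A \<Longrightarrow> u * v \<in> A"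
    and p_zero: "0 \<in> p" and p_one: "1 \<notin> p" and p_add: "\<And>u v. u \<in> p \<Longrightarrow> v \<in> p \<Longrightarrow> u + v \<in> p"
    and p_mult: "\<And>u v. u \<in> p \<Longrightarrow> v * u \<in> p"
    and p_prime: "\<And>u v. u * v \<in> p \<Longrightarrow> u \<in> p \<or> v \<in> p"
begin

lemma A_zero: "0 \<in> A" using A_diff[OF A_one A_one] by simp

lemma A_add: "u \<in> A \<Longrightarrow> v \<in> A \<Longrightarrow> u + v \<in> A"
  using A_diff[of u "0 - v"] A_diff[OF A_zero, of v] by simp

lemma A_sum: "(\<And>i. i \<in> S \<Longrightarrow> f i \<in> A) \<Longrightarrow> sum f S \<in> A"
  by (induction S rule: infinite_finite_induct) (auto simp: A_zero A_add)

lemma A_power: "u \<in> A \<Longrightarrow> u ^ n \<in> A"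
  by (induction n) (auto simp: A_one A_mult)

lemma p_diff: "u \<in> p \<Longrightarrow> v \<in> p \<Longrightarrow> u - v \<in> p"
  using p_add[of u "(-1) * v"] p_mult[of v "-1"] by simp

lemma p_sum: "(\<And>i. i \<in> S \<Longrightarrow> f i \<in> p) \<Longrightarrow> sum f S \<in> p"
  by (induction S rule: infinite_finite_induct) (auto simp: p_zero p_add)

lemma p_power: "u ^ n \<in> p \<Longrightarrow> u \<in> p"
  by (induction n) (use p_one p_prime in auto)

lemma p_cancel: "u - v \<in> p \<Longrightarrow> u \<in> p \<longleftrightarrow> v \<in> p"
  using p_add[of "u - v" v] p_diff[of u "u - v"] by auto

lemma polys_over_ops:
  assumes "g \<in> polys_over A" "h \<in> polys_over A"
  shows "g - h \<in> polys_over A" "g * h \<in> polys_over A" "g + h \<in> polys_over A"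
  using assms by (auto simp: polys_over_def coeff_mult intro!: A_diff A_add A_mult A_sum)

lemma polys_over_simple:
  "0 \<in> polys_over A" "1 \<in> polys_over A"
  "a \<in> A \<Longrightarrow> [:a:] \<in> polys_over A" "a \<in> A \<Longrightarrow> Polynomial.monom a k \<in> polys_over A"
  "a \<in> A \<Longrightarrow> g \<in> polys_over A \<Longrightarrow> Polynomial.smult a g \<in> polys_over A"
  by (auto simp: polys_over_def A_zero A_one A_mult coeff_pCons split: nat.splits)

text \<open>
  Division without fractions: instead of inverting the leading coefficient of \<open>q\<close>, the dividend
  is multiplied by a power of it, so that quotient and remainder keep their coefficients in \<open>A\<close>.
\<close>

lemma pseudo_division:
  assumes q: "q \<in> polys_over A" and "q \<noteq> 0" and g: "g \<in> polys_over A"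
  shows "\<exists>N. \<exists>h\<in>polys_over A. \<exists>r\<in>polys_over A.
    Polynomial.smult (Polynomial.lead_coeff q ^ N) g = h * q + r \<and>
    (r = 0 \<or> Polynomial.degree r < Polynomial.degree q) \<and>
    Polynomial.degree h \<le> Polynomial.degree g - Polynomial.degree q"
  using g
proof (induction "Polynomial.degree g" arbitrary: g rule: less_induct)
  case less
  define l where "l = Polynomial.lead_coeff q"
  have lA: "l \<in> A" using q by (auto simp: polys_over_def l_def)
  consider "g = 0 \<or> Polynomial.degree g < Polynomial.degree q"
    | "g \<noteq> 0" "Polynomial.degree q \<le> Polynomial.degree g" by force
  then show ?case
  proof cases
    case 1
    then show ?thesis
      using less.prems polys_over_simple(1)
      by (intro exI[of _ 0] bexI[of _ 0] bexI[of _ g]) auto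
  next
    case 2
    define m where "m = Polynomial.monom (Polynomial.lead_coeff g) (Polynomial.degree g - Polynomial.degree q)"
    define g' where "g' = Polynomial.smult l g - m * q"
    have mA: "m \<in> polys_over A"
      using less.prems unfolding m_def by (intro polys_over_simple) (auto simp: polys_over_def)
    have g'A: "g' \<in> polys_over A"
      unfolding g'_def using mA lA q less.prems by (intro polys_over_ops polys_over_simple)
    have top: "poly.coeff g' (Polynomial.degree g) = 0"
      using 2 by (simp add: g'_def m_def coeff_monom_mult l_def)
    have dm: "Polynomial.degree m \<le> Polynomial.degree g - Polynomial.degree q"
      unfolding m_def by (rule degree_monom_le)
    have dg': "Polynomial.degree g' \<le> Polynomial.degree g"
      unfolding g'_def using degree_mult_le[of m q] dm 2
      by (intro degree_diff_le) (auto intro: order_trans[OF degree_smult_le])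
    show ?thesis
    proof (cases "g' = 0")
      case True
      then have "Polynomial.smult (l ^ 1) g = m * q + 0" by (simp add: g'_def)
      then show ?thesis
        unfolding l_def using mA polys_over_simple(1) dm by blast
    next
      case False
      then have "Polynomial.degree g' < Polynomial.degree g"
        using top dg' by (metis leading_coeff_0_iff le_neq_implies_less)
      from less.hyps[OF this g'A] obtain N h r where
        h: "h \<in> polys_over A" and r: "r \<in> polys_over A"
        and eq: "Polynomial.smult (l ^ N) g' = h * q + r"
        and deg_r: "r = 0 \<or> Polynomial.degree r < Polynomial.degree q"
        and deg_h: "Polynomial.degree h \<le> Polynomial.degree g' - Polynomial.degree q"
        unfolding l_def by blast
      define h' where "h' = Polynomial.smult (l ^ N) m + h"
      have "Polynomial.smult (l ^ Suc N) g = h' * q + r"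
      proof -
        have "Polynomial.smult (l ^ Suc N) g = Polynomial.smult (l ^ N) (g' + m * q)"
          by (simp add: g'_def mult.commute)
        also have "\<dots> = h' * q + r"
          unfolding smult_add_right eq h'_def by (simp add: algebra_simps)
        finally show ?thesis .
      qed
      moreover have "h' \<in> polys_over A"
        unfolding h'_def using h mA lA by (intro polys_over_ops polys_over_simple A_power)
      moreover have "Polynomial.degree h' \<le> Polynomial.degree g - Polynomial.degree q"
        unfolding h'_def using deg_h dg' dm
        by (intro degree_add_le) (auto intro: order_trans[OF degree_smult_le])
      ultimately show ?thesis unfolding l_def using r deg_r by blast
    qed
  qed
qed

definition coeffs_in_p :: "'b poly \<Rightarrow> bool"
  where "coeffs_in_p g \<longleftrightarrow> (\<forall>i. poly.coeff g i \<in> p)"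

lemma poly_in_p: "coeffs_in_p g \<Longrightarrow> poly g x \<in> p"
  unfolding poly_altdef coeffs_in_p_def
  by (intro p_sum) (metis mult.commute p_mult)

text \<open>
  The degree of a polynomial over the quotient by \<open>p\<close> is read off after the leading coefficients that
  vanish in the quotient have been cut away; the value modulo \<open>p\<close> does not change.
\<close>

lemma strip_leading_coeffs_in_p:
  assumes g: "g \<in> polys_over A" and "\<not> coeffs_in_p g"
  shows "\<exists>g'\<in>polys_over A. Polynomial.degree g' \<le> Polynomial.degree g \<and>
    Polynomial.lead_coeff g' \<notin> p \<and> (\<forall>x. poly g x - poly g' x \<in> p)"
proof -
  let ?S = "{i. poly.coeff g i \<notin> p}"
  have fin: "finite ?S"
    by (rule finite_subset[of _ "{..Polynomial.degree g}"]) (use p_zero in \<open>auto intro: le_degree\<close>)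
  define k where "k = Max ?S"
  have k: "poly.coeff g k \<notin> p" and max: "\<And>i. poly.coeff g i \<notin> p \<Longrightarrow> i \<le> k"
    using Max_in[OF fin] Max_ge[OF fin] assms(2) unfolding k_def coeffs_in_p_def by auto
  define g' where "g' = poly_cutoff (Suc k) g"
  have coeff: "poly.coeff g' i = (if i \<le> k then poly.coeff g i else 0)" for i
    by (simp add: g'_def coeff_poly_cutoff less_Suc_eq_le)
  have deg: "Polynomial.degree g' = k"
    using k p_zero by (intro antisym degree_le le_degree) (auto simp: coeff)
  have "coeffs_in_p (g - g')"
    unfolding coeffs_in_p_def using max by (auto simp: coeff p_zero)
  then have "\<forall>x. poly g x - poly g' x \<in> p"
    using poly_in_p by (metis poly_diff)
  moreover have "g' \<in> polys_over A"
    using g A_zero by (auto simp: polys_over_def coeff)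
  moreover have "k \<le> Polynomial.degree g"
    using k p_zero by (intro le_degree) auto
  ultimately show ?thesis using k by (intro bexI[of _ g']) (auto simp: deg coeff)
qed

text \<open>
  The step from \<open>A\<close> to \<open>A[x]\<close>. If \<open>x\<close> is transcendental over \<open>A\<close> modulo \<open>p\<close>, then any value of \<open>x\<close> is
  compatible with \<open>p\<close>, and one coefficient of \<open>b\<close> that survives under \<open>\<phi>\<close> suffices to find a
  value that is not a zero of \<open>b\<close>. If \<open>x\<close> is algebraic, let \<open>q\<close> be a relation of minimal degree,
  with leading coefficient \<open>l\<close>. When \<open>\<phi> l \<noteq> 0\<close>, every root \<open>c\<close> of the image of \<open>q\<close> is compatible with \<open>p\<close>,
  by division by \<open>q\<close>. Moreover \<open>b\<close> is prime to the irreducible \<open>q\<close>, so some multiple of \<open>b\<close> is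
  congruent to a constant \<open>r\<close> outside \<open>p\<close>, and \<open>\<phi> r \<noteq> 0\<close> prevents \<open>b\<close> from vanishing at \<open>c\<close>.
\<close>

lemma extend_to_simple_extension:
  assumes b: "b \<in> polys_over A" and bx: "poly b x \<notin> p"
  shows "\<exists>a\<in>A - p. \<forall>\<phi>::'b \<Rightarrow> 'c::alg_closed_field.
    unital_hom \<phi> \<and> (\<forall>y\<in>A \<inter> p. \<phi> y = 0) \<and> \<phi> a \<noteq> 0 \<longrightarrow>
    (\<exists>c. (\<forall>g\<in>polys_over A. poly g x \<in> p \<longrightarrow> poly (map_poly \<phi> g) c = 0) \<and>
         poly (map_poly \<phi> b) c \<noteq> 0)"
proof -
  define Q where "Q = {g \<in> polys_over A. poly g x \<in> p}"
  have kill: "map_poly \<phi> g = 0" if "unital_hom \<phi>" "\<forall>y\<in>A \<inter> p. \<phi> y = 0" "g \<in> polys_over A" "coeffs_in_p g"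
    for \<phi> :: "'b \<Rightarrow> 'c" and g
    using that by (intro unital_hom.map_poly_zero_if) (auto simp: polys_over_def coeffs_in_p_def)
  show ?thesis
  proof (cases "\<forall>g\<in>Q. coeffs_in_p g")
    case True
    from poly_in_p bx have "\<not> coeffs_in_p b" by blast
    then obtain i where i: "poly.coeff b i \<notin> p" unfolding coeffs_in_p_def by blast
    show ?thesis
    proof (intro bexI[of _ "poly.coeff b i"] allI impI)
      show "poly.coeff b i \<in> A - p" using b i by (auto simp: polys_over_def)
      fix \<phi> :: "'b \<Rightarrow> 'c"
      assume \<phi>: "unital_hom \<phi> \<and> (\<forall>y\<in>A \<inter> p. \<phi> y = 0) \<and> \<phi> (poly.coeff b i) \<noteq> 0"
      then have "poly.coeff (map_poly \<phi> b) i \<noteq> 0" by (simp add: coeff_map_poly unital_hom.hom_zero)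
      then have "map_poly \<phi> b \<noteq> 0" by auto
      then obtain c where "poly (map_poly \<phi> b) c \<noteq> 0" using exists_non_root by blast
      moreover have "map_poly \<phi> g = 0" if "g \<in> polys_over A" "poly g x \<in> p" for g
        using kill[of \<phi> g] \<phi> True that by (auto simp: Q_def)
      ultimately show "\<exists>c. (\<forall>g\<in>polys_over A. poly g x \<in> p \<longrightarrow> poly (map_poly \<phi> g) c = 0) \<and>
         poly (map_poly \<phi> b) c \<noteq> 0" by (intro exI[of _ c]) auto
    qed
  next
    case False
    define Q' where "Q' = {g \<in> Q. Polynomial.lead_coeff g \<notin> p}"
    have strip_Q: "\<exists>g'\<in>Q'. Polynomial.degree g' \<le> Polynomial.degree g" if "g \<in> Q" "\<not> coeffs_in_p g" for g
    proof -
      from that(1) have gA: "g \<in> polys_over A" and gx: "poly g x \<in> p" by (auto simp: Q_def)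
      from strip_leading_coeffs_in_p[OF gA that(2)] obtain g' where
        "g' \<in> polys_over A" "Polynomial.degree g' \<le> Polynomial.degree g"
        "Polynomial.lead_coeff g' \<notin> p" "poly g x - poly g' x \<in> p" by blast
      then show ?thesis using gx p_cancel unfolding Q'_def Q_def by blast
    qed
    then have "\<exists>g. g \<in> Q'" using False by blast
    then obtain q where q: "q \<in> Q'"
      and q_min: "\<And>g. g \<in> Q' \<Longrightarrow> Polynomial.degree q \<le> Polynomial.degree g"
      using exists_least_iff[of "\<lambda>d. \<exists>g\<in>Q'. Polynomial.degree g = d"] by (metis not_less)
    have qA: "q \<in> polys_over A" and qx: "poly q x \<in> p" and ql: "Polynomial.lead_coeff q \<notin> p"
      using q by (auto simp: Q'_def Q_def)
    define l where "l = Polynomial.lead_coeff q"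
    define d where "d = Polynomial.degree q"
    have lA: "l \<in> A" using qA by (auto simp: polys_over_def l_def)
    have q0: "q \<noteq> 0" using ql p_zero by auto
    have d_pos: "d > 0"
    proof (rule ccontr)
      assume "\<not> d > 0"
      then obtain a where "q = [:a:]" unfolding d_def by (metis degree_eq_zeroE neq0_conv)
      then show False using qx ql by auto
    qed
    have small_Q: "coeffs_in_p g" if "g \<in> Q" "Polynomial.degree g < d" for g
      using strip_Q[OF that(1)] q_min that(2) unfolding d_def by force
    \<comment> \<open>Representatives of the multiples of \<open>b\<close> outside \<open>p\<close>; one of minimal degree will be constant.\<close>
    define M where "M = {r \<in> polys_over A. Polynomial.lead_coeff r \<notin> p \<and> poly r x \<notin> p \<and>
      (\<exists>h\<in>polys_over A. poly r x - poly (h * b) x \<in> p)}"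
    have strip_M: "\<exists>r'\<in>M. Polynomial.degree r' \<le> Polynomial.degree r"
      if rA: "r \<in> polys_over A" and rx: "poly r x \<notin> p"
        and hA: "h \<in> polys_over A" and rh: "poly r x - poly (h * b) x \<in> p" for r h
    proof -
      have "\<not> coeffs_in_p r" using rx poly_in_p by blast
      from strip_leading_coeffs_in_p[OF rA this] obtain r' where r':
        "r' \<in> polys_over A" "Polynomial.degree r' \<le> Polynomial.degree r"
        "Polynomial.lead_coeff r' \<notin> p" "poly r x - poly r' x \<in> p" by blast
      have "poly r' x - poly (h * b) x \<in> p"
        using p_diff[OF rh r'(4)] by (simp add: algebra_simps)
      moreover have "poly r' x \<notin> p" using r'(4) rx p_cancel by blast
      ultimately show ?thesis using r' hA unfolding M_def by blast
    qed
    have "\<exists>r. r \<in> M"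
      using strip_M[OF b bx polys_over_simple(2)] p_zero by auto
    then obtain r where r: "r \<in> M"
      and r_min: "\<And>r'. r' \<in> M \<Longrightarrow> Polynomial.degree r \<le> Polynomial.degree r'"
      using exists_least_iff[of "\<lambda>d. \<exists>g\<in>M. Polynomial.degree g = d"] by (metis not_less)
    obtain h where rA: "r \<in> polys_over A" and rl: "Polynomial.lead_coeff r \<notin> p" and rx: "poly r x \<notin> p"
      and hA: "h \<in> polys_over A" and rh: "poly r x - poly (h * b) x \<in> p"
      using r by (auto simp: M_def)
    have r0: "r \<noteq> 0" using rl p_zero by auto
    \<comment> \<open>Otherwise division by \<open>q\<close> would lower the degree of \<open>r\<close>.\<close>
    have r_lt: "Polynomial.degree r < d"
    proof (rule ccontr)
      assume ge: "\<not> Polynomial.degree r < d"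
      obtain N h' s where h': "h' \<in> polys_over A" and s: "s \<in> polys_over A"
        and eq: "Polynomial.smult (l ^ N) r = h' * q + s"
        and deg_s: "s = 0 \<or> Polynomial.degree s < d"
        using pseudo_division[OF qA q0 rA] unfolding l_def d_def by blast
      have eqx: "l ^ N * poly r x = poly h' x * poly q x + poly s x"
        using arg_cong[OF eq, of "\<lambda>f. poly f x"] by simp
      have lr: "l ^ N * poly r x \<notin> p" using ql rx p_power p_prime unfolding l_def by blast
      have hq: "poly h' x * poly q x \<in> p" using qx p_mult by blast
      have sx: "poly s x \<notin> p" using lr hq p_add unfolding eqx by blast
      have "poly s x - poly (Polynomial.smult (l ^ N) h * b) x
          = l ^ N * (poly r x - poly (h * b) x) - poly h' x * poly q x"
        using eqx by (simp add: algebra_simps)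
      also have "\<dots> \<in> p" by (rule p_diff[OF p_mult[OF rh] hq])
      finally obtain r' where "r' \<in> M" "Polynomial.degree r' \<le> Polynomial.degree s"
        using strip_M[OF s sx] polys_over_simple(5)[OF A_power[OF lA] hA] by blast
      moreover have "s \<noteq> 0" using sx p_zero by auto
      ultimately show False using r_min deg_s ge by fastforce
    qed
    \<comment> \<open>Otherwise dividing \<open>q\<close> by \<open>r\<close> leaves a remainder that vanishes modulo \<open>p\<close>, and the quotient is a relation for \<open>x\<close> of smaller degree than \<open>q\<close>.\<close>
    have r_const: "Polynomial.degree r = 0"
    proof (rule ccontr)
      assume pos: "Polynomial.degree r \<noteq> 0"
      define e where "e = Polynomial.lead_coeff r"
      have eA: "e \<in> A" using rA by (auto simp: polys_over_def e_def)
      obtain N h' s where h': "h' \<in> polys_over A" and s: "s \<in> polys_over A"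
        and eq: "Polynomial.smult (e ^ N) q = h' * r + s"
        and deg_s: "s = 0 \<or> Polynomial.degree s < Polynomial.degree r"
        and deg_h': "Polynomial.degree h' \<le> d - Polynomial.degree r"
        using pseudo_division[OF rA r0 qA] unfolding e_def d_def by blast
      have eqx: "e ^ N * poly q x = poly h' x * poly r x + poly s x"
        using arg_cong[OF eq, of "\<lambda>f. poly f x"] by simp
      have eq_in: "e ^ N * poly q x \<in> p" using qx p_mult by blast
      have sx: "poly s x \<in> p"
      proof (rule ccontr)
        assume sx: "poly s x \<notin> p"
        have "poly s x - poly ((0 - h' * h) * b) x
            = e ^ N * poly q x - poly h' x * (poly r x - poly (h * b) x)"
          using eqx by (simp add: algebra_simps)
        also have "\<dots> \<in> p" by (rule p_diff[OF eq_in p_mult[OF rh]])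
        finally obtain r' where "r' \<in> M" "Polynomial.degree r' \<le> Polynomial.degree s"
          using strip_M[OF s sx] polys_over_ops(1)[OF polys_over_simple(1) polys_over_ops(2)[OF h' hA]]
          by blast
        moreover have "s \<noteq> 0" using sx p_zero by auto
        ultimately show False using r_min deg_s by fastforce
      qed
      have s_p: "coeffs_in_p s"
      proof (cases "s = 0")
        case True
        then show ?thesis by (simp add: coeffs_in_p_def p_zero)
      next
        case False
        then show ?thesis using small_Q[of s] s sx deg_s r_lt by (auto simp: Q_def)
      qed
      have "poly h' x * poly r x \<in> p"
        using p_diff[OF eq_in sx] by (simp add: eqx)
      then have "h' \<in> Q" using p_prime rx h' by (auto simp: Q_def)
      moreover have "Polynomial.degree h' < d" using deg_h' pos r_lt by linarith
      ultimately have h'_p: "coeffs_in_p h'" by (rule small_Q)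
      have "poly.coeff (h' * r + s) d \<in> p"
        using h'_p s_p unfolding coeffs_in_p_def coeff_add coeff_mult
        by (intro p_add p_sum) (metis mult.commute p_mult, blast)
      then have "e ^ N * l \<in> p" by (simp flip: eq add: l_def d_def)
      then show False using p_prime p_power rl ql unfolding e_def l_def by blast
    qed
    then obtain a where ra: "r = [:a:]" by (rule degree_eq_zeroE)
    have aA: "a \<in> A" using rA unfolding ra polys_over_def by (auto dest: spec[of _ 0])
    have ap: "a \<notin> p" using rl ra by simp
    show ?thesis
    proof (intro bexI[of _ "l * a"] allI impI)
      show "l * a \<in> A - p"
        using lA aA A_mult p_prime ap ql unfolding l_def by blast
      fix \<phi> :: "'b \<Rightarrow> 'c"
      assume *: "unital_hom \<phi> \<and> (\<forall>y\<in>A \<inter> p. \<phi> y = 0) \<and> \<phi> (l * a) \<noteq> 0"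
      interpret unital_hom \<phi> using * by blast
      have \<phi>l: "\<phi> l \<noteq> 0" and \<phi>a: "\<phi> a \<noteq> 0" using * by (auto simp: hom_mult)
      have "d \<le> Polynomial.degree (map_poly \<phi> q)"
        using \<phi>l by (intro le_degree) (simp add: coeff_map_poly hom_zero l_def d_def)
      then obtain c where c: "poly (map_poly \<phi> q) c = 0"
        using alg_closed_imp_poly_has_root[of "map_poly \<phi> q"] d_pos by auto
      have vanish: "poly (map_poly \<phi> g) c = 0" if gA: "g \<in> polys_over A" and gx: "poly g x \<in> p" for g
      proof -
        obtain N h' s where h': "h' \<in> polys_over A" and s: "s \<in> polys_over A"
          and eq: "Polynomial.smult (l ^ N) g = h' * q + s"
          and deg_s: "s = 0 \<or> Polynomial.degree s < d"
          using pseudo_division[OF qA q0 gA] unfolding l_def d_def by blast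
        have "poly s x = l ^ N * poly g x - poly h' x * poly q x"
          using arg_cong[OF eq, of "\<lambda>f. poly f x"] by simp
        also have "\<dots> \<in> p" using gx qx by (intro p_diff p_mult)
        finally have "coeffs_in_p s"
          using small_Q[of s] s deg_s by (cases "s = 0") (auto simp: Q_def coeffs_in_p_def p_zero)
        then have "map_poly \<phi> s = 0" using kill * s by blast
        then have "\<phi> (l ^ N) * poly (map_poly \<phi> g) c = 0"
          using arg_cong[OF eq, of "\<lambda>f. poly (map_poly \<phi> f) c"] c
          by (simp add: map_poly_smult map_poly_add map_poly_mult)
        then show ?thesis using \<phi>l by (simp add: hom_power)
      qed
      have "poly (map_poly \<phi> (r - h * b)) c = 0"
        using rA hA b rh by (intro vanish polys_over_ops) simp_all
      then have "\<phi> a = poly (map_poly \<phi> h) c * poly (map_poly \<phi> b) c"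
        by (simp add: map_poly_diff map_poly_mult ra map_poly_pCons hom_zero)
      then show "\<exists>c. (\<forall>g\<in>polys_over A. poly g x \<in> p \<longrightarrow> poly (map_poly \<phi> g) c = 0) \<and>
         poly (map_poly \<phi> b) c \<noteq> 0"
        using vanish \<phi>a by (intro exI[of _ c]) auto
    qed
  qed
qed

end

lemma mpoly_monomial_sum:
  "f = (\<Sum>s\<in>Poly_Mapping.keys f. Poly_Mapping.single s (Poly_Mapping.lookup f s))"
proof (rule poly_mapping_eqI)
  fix k
  have "(\<Sum>s\<in>Poly_Mapping.keys f. Poly_Mapping.lookup (Poly_Mapping.single s (Poly_Mapping.lookup f s)) k)
      = (\<Sum>s\<in>Poly_Mapping.keys f. if s = k then Poly_Mapping.lookup f s else 0)"
    by (intro sum.cong) (auto simp: lookup_single when_def)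
  then show "Poly_Mapping.lookup f k = Poly_Mapping.lookup
      (\<Sum>s\<in>Poly_Mapping.keys f. Poly_Mapping.single s (Poly_Mapping.lookup f s)) k"
    by (simp add: lookup_sum in_keys_iff)
qed

lemma mpoly_induct [case_names zero monomial add]:
  fixes f :: "'a \<Rightarrow>\<^sub>0 'b::comm_monoid_add"
  assumes "P 0" "\<And>s c. s \<in> Poly_Mapping.keys f \<Longrightarrow> P (Poly_Mapping.single s c)"
    "\<And>g h. P g \<Longrightarrow> P h \<Longrightarrow> P (g + h)"
  shows "P f"
proof -
  have "P (\<Sum>s\<in>S. Poly_Mapping.single s (Poly_Mapping.lookup f s))" if "S \<subseteq> Poly_Mapping.keys f" for S
    using finite_subset[OF that finite_keys] that
    by (induction S rule: finite_induct) (auto intro: assms)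
  from this[of "Poly_Mapping.keys f"] show ?thesis by (simp flip: mpoly_monomial_sum)
qed

context
  fixes \<Gamma> :: "'x::finite \<Rightarrow> 'k::field alg_closure"
begin

lemma eval_ac_superset:
  assumes "finite S" "Poly_Mapping.keys f \<subseteq> S"
  shows "eval_ac \<Gamma> f = (\<Sum>s\<in>S. to_ac (Poly_Mapping.lookup f s) * (\<Prod>x\<in>UNIV. \<Gamma> x ^ Poly_Mapping.lookup s x))"
proof -
  have "(\<Prod>x\<in>Poly_Mapping.keys s. \<Gamma> x ^ Poly_Mapping.lookup s x) = (\<Prod>x\<in>UNIV. \<Gamma> x ^ Poly_Mapping.lookup s x)" for s
    by (intro prod.mono_neutral_left) (auto simp: in_keys_iff)
  then show ?thesis
    unfolding eval_ac_def using assms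
    by (intro sum.mono_neutral_cong_left) (auto simp: in_keys_iff)
qed

lemma eval_ac_single:
  "eval_ac \<Gamma> (Poly_Mapping.single s c) = to_ac c * (\<Prod>x\<in>UNIV. \<Gamma> x ^ Poly_Mapping.lookup s x)"
  by (subst eval_ac_superset[of "{s}"]) auto

lemma eval_ac_add: "eval_ac \<Gamma> (f + g) = eval_ac \<Gamma> f + eval_ac \<Gamma> g"
proof -
  let ?S = "Poly_Mapping.keys f \<union> Poly_Mapping.keys g"
  have "Poly_Mapping.keys (f + g) \<subseteq> ?S" by (rule keys_add)
  then show ?thesis
    by (simp add: eval_ac_superset[of ?S] lookup_add algebra_simps sum.distrib)
qed

lemma eval_ac_mult: "eval_ac \<Gamma> (f * g) = eval_ac \<Gamma> f * eval_ac \<Gamma> g"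
proof (induction f rule: mpoly_induct)
  case (monomial s c)
  show ?case
  proof (induction g rule: mpoly_induct)
    case (monomial u d)
    show ?case
      by (simp add: mult_single eval_ac_single lookup_add power_add prod.distrib)
  qed (auto simp: eval_ac_add distrib_left eval_ac_def[of _ 0])
qed (auto simp: eval_ac_add distrib_right eval_ac_def[of _ 0])

lemma unital_hom_eval_ac: "unital_hom (eval_ac \<Gamma>)"
  by unfold_locales
    (use eval_ac_single[of 0 1] in \<open>auto simp: eval_ac_add eval_ac_mult\<close>)

lemma eval_ac_var [simp]: "eval_ac \<Gamma> (mpoly_var x) = \<Gamma> x"
proof -
  have "(\<Prod>y\<in>UNIV. \<Gamma> y ^ (1 when x = y)) = (\<Prod>y\<in>{x}. \<Gamma> y)"
    by (intro prod.mono_neutral_cong_right) (auto simp: when_def)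
  then show ?thesis
    unfolding mpoly_var_def var_term_def by (simp add: eval_ac_single lookup_single)
qed

end

lemma primeideal_mpoly_ringD:
  fixes p :: "('x, 'k::field) mpoly set"
  assumes "primeideal p mpoly_ring"
  shows "0 \<in> p" "1 \<notin> p" "u \<in> p \<Longrightarrow> v \<in> p \<Longrightarrow> u + v \<in> p" "u \<in> p \<Longrightarrow> v * u \<in> p"
    "u * v \<in> p \<Longrightarrow> u \<in> p \<or> v \<in> p"
proof -
  interpret primeideal p mpoly_ring by (rule assms)
  show "0 \<in> p" "u \<in> p \<Longrightarrow> v \<in> p \<Longrightarrow> u + v \<in> p" "u \<in> p \<Longrightarrow> v * u \<in> p" "u * v \<in> p \<Longrightarrow> u \<in> p \<or> v \<in> p"
    using additive_subgroup.zero_closed[OF is_additive_subgroup]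
      additive_subgroup.a_closed[OF is_additive_subgroup, of u v] I_l_closed[of u v] I_prime[of u v]
    by (auto simp: ring_of_type_algebra_def)
  show "1 \<notin> p"
    using I_notcarr one_imp_carrier by (auto simp: ring_of_type_algebra_def)
qed

definition mpolys_in :: "'x set \<Rightarrow> ('x, 'k::field) mpoly set"
  where "mpolys_in V = {f. \<forall>s\<in>Poly_Mapping.keys f. Poly_Mapping.keys s \<subseteq> V}"

lemma prime_and_subring_mpolys_in:
  fixes p :: "('x, 'k::field) mpoly set"
  assumes "primeideal p mpoly_ring"
  shows "prime_and_subring (mpolys_in V) p"
proof
  show "1 \<in> (mpolys_in V :: ('x, 'k) mpoly set)" by (simp add: mpolys_in_def)
  fix u v :: "('x, 'k) mpoly" assume uv: "u \<in> mpolys_in V" "v \<in> mpolys_in V"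
  have "Poly_Mapping.keys (u - v) \<subseteq> Poly_Mapping.keys u \<union> Poly_Mapping.keys v"
    by (auto simp: in_keys_iff lookup_minus)
  then show "u - v \<in> mpolys_in V" using uv unfolding mpolys_in_def by blast
  show "u * v \<in> mpolys_in V"
    unfolding mpolys_in_def
  proof safe
    fix s x assume "s \<in> Poly_Mapping.keys (u * v)" "x \<in> Poly_Mapping.keys s"
    then obtain a c where "a \<in> Poly_Mapping.keys u" "c \<in> Poly_Mapping.keys v" "x \<in> Poly_Mapping.keys (a + c)"
      using keys_mult[of u v] by blast
    then show "x \<in> V" using keys_add[of a c] uv unfolding mpolys_in_def by blast
  qed
qed (use primeideal_mpoly_ringD[OF assms] in auto)

lemma mpoly_as_poly_in_new_variable:
  fixes f :: "('x, 'k::field) mpoly"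
  assumes "f \<in> mpolys_in (insert x V)"
  shows "\<exists>g\<in>polys_over (mpolys_in V). f = poly g (mpoly_var x)"
proof -
  have closed: "g + h \<in> mpolys_in V" if "g \<in> mpolys_in V" "h \<in> mpolys_in V" for g h :: "('x, 'k) mpoly"
    using that keys_add[of g h] unfolding mpolys_in_def by blast
  have var_power: "mpoly_var x ^ n = Poly_Mapping.single (Poly_Mapping.single x n) (1::'k)" for n
    by (induction n) (auto simp: mpoly_var_def var_term_def mult_single simp flip: single_add)
  show ?thesis
  proof (induction f rule: mpoly_induct)
    case zero
    show ?case by (rule bexI[of _ 0]) (auto simp: polys_over_def mpolys_in_def)
  next
    case (monomial s c)
    define s' where "s' = Poly_Mapping.update x 0 s"
    have s: "s = s' + Poly_Mapping.single x (Poly_Mapping.lookup s x)"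
      by (rule poly_mapping_eqI) (auto simp: s'_def lookup_update lookup_add lookup_single when_def)
    have "Poly_Mapping.keys s' \<subseteq> V"
      using monomial assms by (auto simp: s'_def keys_update mpolys_in_def)
    then have "Polynomial.monom (Poly_Mapping.single s' c) (Poly_Mapping.lookup s x) \<in> polys_over (mpolys_in V)"
      by (auto simp: polys_over_def mpolys_in_def)
    moreover have "Poly_Mapping.single s c =
        poly (Polynomial.monom (Poly_Mapping.single s' c) (Poly_Mapping.lookup s x)) (mpoly_var x)"
      by (simp add: poly_monom var_power mult_single flip: s)
    ultimately show ?case by blast
  next
    case (add g h)
    then obtain g' h' where "g' \<in> polys_over (mpolys_in V)" "h' \<in> polys_over (mpolys_in V)"
      "g = poly g' (mpoly_var x)" "h = poly h' (mpoly_var x)" by blast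
    then show ?case using closed by (intro bexI[of _ "g' + h'"]) (auto simp: polys_over_def)
  qed
qed

lemma eval_ac_cong:
  assumes "f \<in> mpolys_in V" "\<And>x. x \<in> V \<Longrightarrow> \<Gamma> x = \<Gamma>' x"
  shows "eval_ac \<Gamma> f = eval_ac \<Gamma>' f"
  unfolding eval_ac_def using assms
  by (intro sum.cong arg_cong2[of _ _ _ _ "(*)"] prod.cong refl)
    (force simp: mpolys_in_def intro!: arg_cong2[of _ _ _ _ "(^)"])

text \<open>
  Indeterminates receive their values one at a time. The element \<open>b\<close> that must not vanish is first
  traded for one with fewer indeterminates; in the end it is a nonzero constant, where nothing
  remains to be chosen.
\<close>

lemma nullstellensatz_in_variables:
  fixes p :: "('x::finite, 'k::field) mpoly set"
  assumes p: "primeideal p mpoly_ring" and "b \<in> mpolys_in V - p"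
  shows "\<exists>\<Gamma>. (\<forall>f\<in>mpolys_in V \<inter> p. eval_ac \<Gamma> f = 0) \<and> eval_ac \<Gamma> b \<noteq> 0"
proof -
  have "finite V" by simp
  then show ?thesis using assms(2)
  proof (induction V arbitrary: b rule: finite_induct)
    case empty
    have const: "\<exists>c. f = Poly_Mapping.single 0 c" if "f \<in> mpolys_in {}" for f :: "('x, 'k) mpoly"
    proof -
      have "f = Poly_Mapping.single 0 (Poly_Mapping.lookup f 0)"
        using that by (intro poly_mapping_eqI) (auto simp: mpolys_in_def lookup_single when_def in_keys_iff)
      then show ?thesis ..
    qed
    have "c = 0" if "Poly_Mapping.single 0 c \<in> p" for c :: 'k
      using primeideal_mpoly_ringD(2)[OF p] primeideal_mpoly_ringD(4)[OF p that, of "Poly_Mapping.single 0 (inverse c)"]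
      by (cases "c = 0") (auto simp: mult_single)
    moreover obtain c where c: "b = Poly_Mapping.single 0 c" "c \<noteq> 0"
      using const[of b] empty.prems primeideal_mpoly_ringD(1)[OF p] by force
    moreover have "to_ac c \<noteq> 0" using c(2) to_ac_0 to_ac_eq_iff by metis
    ultimately show ?case
      using const by (intro exI[of _ "\<lambda>_. 0"]) (force simp: eval_ac_single)
  next
    case (insert x V)
    interpret prime_and_subring "mpolys_in V" p by (rule prime_and_subring_mpolys_in[OF p])
    obtain g where g: "g \<in> polys_over (mpolys_in V)" "b = poly g (mpoly_var x)"
      using mpoly_as_poly_in_new_variable[of b x V] insert.prems by auto
    have "poly g (mpoly_var x) \<notin> p" using g(2) insert.prems by blast
    from extend_to_simple_extension[OF g(1) this, where ?'c = "'k alg_closure"]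
    obtain a where a: "a \<in> mpolys_in V - p" and ext: "\<forall>\<phi> :: ('x, 'k) mpoly \<Rightarrow> 'k alg_closure.
      unital_hom \<phi> \<and> (\<forall>y\<in>mpolys_in V \<inter> p. \<phi> y = 0) \<and> \<phi> a \<noteq> 0 \<longrightarrow>
      (\<exists>c. (\<forall>h\<in>polys_over (mpolys_in V). poly h (mpoly_var x) \<in> p \<longrightarrow> poly (map_poly \<phi> h) c = 0) \<and>
         poly (map_poly \<phi> g) c \<noteq> 0)" by (rule bexE)
    from insert.IH[OF a] obtain \<Gamma> where
      \<Gamma>: "\<forall>f\<in>mpolys_in V \<inter> p. eval_ac \<Gamma> f = 0" "eval_ac \<Gamma> a \<noteq> 0" by blast
    from ext[rule_format, OF conjI[OF unital_hom_eval_ac conjI[OF \<Gamma>]]] obtain c where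
      c: "\<And>h. h \<in> polys_over (mpolys_in V) \<Longrightarrow> poly h (mpoly_var x) \<in> p \<Longrightarrow> poly (map_poly (eval_ac \<Gamma>) h) c = 0"
        "poly (map_poly (eval_ac \<Gamma>) g) c \<noteq> 0" by blast
    define \<Gamma>' where "\<Gamma>' = \<Gamma>(x := c)"
    interpret ev: unital_hom "eval_ac \<Gamma>'" by (rule unital_hom_eval_ac)
    have eval: "eval_ac \<Gamma>' (poly h (mpoly_var x)) = poly (map_poly (eval_ac \<Gamma>) h) c"
      if "h \<in> polys_over (mpolys_in V)" for h
    proof -
      have "map_poly (eval_ac \<Gamma>') h = map_poly (eval_ac \<Gamma>) h"
        using that insert.hyps(2) unfolding \<Gamma>'_def
        by (intro poly_eqI) (auto simp: polys_over_def coeff_map_poly unital_hom.hom_zero[OF unital_hom_eval_ac]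
            intro!: eval_ac_cong[of _ V])
      then show ?thesis unfolding ev.hom_poly by (simp add: \<Gamma>'_def)
    qed
    have "eval_ac \<Gamma>' f = 0" if f: "f \<in> mpolys_in (insert x V) \<inter> p" for f
    proof -
      obtain h where "h \<in> polys_over (mpolys_in V)" "f = poly h (mpoly_var x)"
        using mpoly_as_poly_in_new_variable[of f x V] f by auto
      then show ?thesis using eval c(1) f by auto
    qed
    then show ?case using eval[OF g(1)] c(2) g(2) by (intro exI[of _ \<Gamma>']) auto
  qed
qed

theorem nullstellensatz:
  fixes p :: "('x::finite, 'k::field) mpoly set"
  assumes "primeideal p mpoly_ring" and "f \<notin> p"
  shows "\<exists>\<Gamma>. p \<subseteq> point_ideal \<Gamma> \<and> f \<notin> point_ideal \<Gamma>"
  using nullstellensatz_in_variables[OF assms(1), of f UNIV] assms(2)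
  by (auto simp: mpolys_in_def point_ideal_def)

section \<open>Dimensions in quotients of the polynomial ring\<close>

lemma mpoly_ring_simps [simp]:
  "carrier mpoly_ring = UNIV" "x \<otimes>\<^bsub>mpoly_ring\<^esub> y = x * y" "x \<oplus>\<^bsub>mpoly_ring\<^esub> y = x + y"
  "\<one>\<^bsub>mpoly_ring\<^esub> = 1" "\<zero>\<^bsub>mpoly_ring\<^esub> = 0"
  by (simp_all add: ring_of_type_algebra_def)

lemma mpoly_const_simps:
  "mpoly_const 0 = 0" "mpoly_const 1 = 1" "mpoly_const (c + d) = mpoly_const c + mpoly_const d"
  "mpoly_const (c * d) = mpoly_const c * mpoly_const d"
  by (simp_all add: mpoly_const_def single_add mult_single)

lemma ideal_mpoly_ringI:
  fixes I :: "('x, 'k::field) mpoly set"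
  assumes "0 \<in> I" "\<And>f g. f \<in> I \<Longrightarrow> g \<in> I \<Longrightarrow> f + g \<in> I" "\<And>f g. f \<in> I \<Longrightarrow> g * f \<in> I"
  shows "ideal I mpoly_ring"
proof (rule idealI)
  show "ring (mpoly_ring :: ('x, 'k) mpoly ring)" by (rule ring_from_type_algebra)
  then interpret R: ring "mpoly_ring :: ('x, 'k) mpoly ring" .
  show "subgroup I (add_monoid (mpoly_ring :: ('x, 'k) mpoly ring))"
  proof (rule R.add.subgroupI)
    fix f assume "f \<in> I"
    have "\<ominus>\<^bsub>mpoly_ring\<^esub> f = - f"
      by (rule R.minus_equality) auto
    then show "\<ominus>\<^bsub>mpoly_ring\<^esub> f \<in> I" using assms(3)[OF \<open>f \<in> I\<close>, of "-1"] by simp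
  qed (use assms in auto)
qed (use assms in \<open>auto simp: mult.commute\<close>)

text \<open>
  A linear map to \<open>L^m\<close> whose kernel \<open>I\<close> is an ideal identifies \<open>P/I\<close> with a space of column vectors.
  This replaces the dimension predicate for embedded algebras by dimensions of spans of
  vectors.
\<close>

locale linear_quotient =
  fixes \<phi> :: "('x, 'l::field) mpoly \<Rightarrow> 'l ^ 'm::finite"
  assumes \<phi>_add: "\<And>f g. \<phi> (f + g) = \<phi> f + \<phi> g"
    and \<phi>_scale: "\<And>c f. \<phi> (mpoly_const c * f) = c *s \<phi> f"
    and ideal: "ideal {f. \<phi> f = 0} mpoly_ring"
begin

definition "I = {f. \<phi> f = 0}"
definition "\<pi> f = I +>\<^bsub>mpoly_ring\<^esub> f"

lemma \<phi>_diff: "\<phi> (f - g) = \<phi> f - \<phi> g"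
  using \<phi>_add[of "f - g" g] by simp

lemma \<phi>_zero: "\<phi> 0 = 0"
  using \<phi>_add[of 0 0] by simp

lemma \<pi>_alt: "\<pi> f = {g. \<phi> g = \<phi> f}"
proof -
  have "\<pi> f = (\<lambda>i. i + f) ` I" by (auto simp: \<pi>_def a_r_coset_def')
  also have "\<dots> = {g. \<phi> g = \<phi> f}"
    by (auto simp: I_def \<phi>_add \<phi>_diff intro!: image_eqI[of _ _ "_ - f"])
  finally show ?thesis .
qed

lemma \<pi>_eq_iff: "\<pi> f = \<pi> g \<longleftrightarrow> \<phi> f = \<phi> g"
  by (auto simp: \<pi>_alt)

abbreviation "Q \<equiv> mpoly_ring Quot I"

sublocale I: ideal I mpoly_ring using ideal by (simp add: I_def)
sublocale Q: ring Q by (rule I.quotient_is_ring)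

lemma \<pi>_ops: "\<pi> f \<oplus>\<^bsub>Q\<^esub> \<pi> g = \<pi> (f + g)" "\<pi> f \<otimes>\<^bsub>Q\<^esub> \<pi> g = \<pi> (f * g)" "\<pi> f \<in> carrier Q"
  using ring_hom_add[OF I.rcos_ring_hom, of f g] ring_hom_mult[OF I.rcos_ring_hom, of f g]
    ring_hom_closed[OF I.rcos_ring_hom, of f]
  by (simp_all add: \<pi>_def)

lemma \<pi>_one: "\<pi> 1 = \<one>\<^bsub>Q\<^esub>"
  using ring_hom_one[OF I.rcos_ring_hom] by (simp add: \<pi>_def)

lemma \<pi>_zero: "\<pi> 0 = \<zero>\<^bsub>Q\<^esub>"
  using \<phi>_zero by (simp add: \<pi>_alt FactRing_def I_def)

lemma quot_consts_eq: "quot_consts I = range (\<lambda>c. \<pi> (mpoly_const c))"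
  by (auto simp: quot_consts_def \<pi>_def)

text \<open>
  The dimension predicate is generated by extensions by one line, and adding one vector to a basis is
  precisely such an extension.
\<close>

lemma dimension_span:
  assumes "finite B" "vec.independent B" "B \<subseteq> range \<phi>"
  shows "Q.dimension (card B) (quot_consts I) (\<pi> ` {f. \<phi> f \<in> vec.span B})"
  using assms
proof (induction B rule: finite_induct)
  case empty
  have "\<pi> ` {f. \<phi> f \<in> vec.span {}} = (\<lambda>_. \<pi> 0) ` {f. \<phi> f \<in> vec.span {}}"
    by (rule image_cong) (simp_all add: \<pi>_eq_iff \<phi>_zero)
  also have "\<dots> = {\<zero>\<^bsub>Q\<^esub>}"
    using \<phi>_zero by (simp add: image_constant[of 0] flip: \<pi>_zero)
  finally have "\<pi> ` {f. \<phi> f \<in> vec.span {}} = {\<zero>\<^bsub>Q\<^esub>}" .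
  then show ?case by (simp add: Q.zero_dim)
next
  case (insert v B)
  then obtain f0 where f0: "v = \<phi> f0" by auto
  let ?E = "\<pi> ` {f. \<phi> f \<in> vec.span B}"
  have "\<pi> f0 \<notin> ?E"
    using insert.prems(1) insert.hyps(2) by (auto simp: \<pi>_eq_iff f0 vec.independent_insert)
  moreover have "Q.dimension (card B) (quot_consts I) ?E"
    using insert by (auto simp: vec.independent_insert)
  ultimately have "Q.dimension (Suc (card B)) (quot_consts I) (Q.line_extension (quot_consts I) (\<pi> f0) ?E)"
    by (intro Q.Suc_dim \<pi>_ops)
  also have "Q.line_extension (quot_consts I) (\<pi> f0) ?E = \<pi> ` {f. \<phi> f \<in> vec.span (insert v B)}"
  proof -
    have "u \<in> Q.line_extension (quot_consts I) (\<pi> f0) ?E \<longleftrightarrow>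
        (\<exists>c g. \<phi> g \<in> vec.span B \<and> u = \<pi> (mpoly_const c * f0 + g))" for u
      unfolding Q.line_extension_mem_iff quot_consts_eq by (auto simp: \<pi>_ops)
    moreover have "(\<exists>c g. \<phi> g \<in> vec.span B \<and> u = \<pi> (mpoly_const c * f0 + g)) \<longleftrightarrow>
        u \<in> \<pi> ` {f. \<phi> f \<in> vec.span (insert v B)}" for u
    proof
      assume "\<exists>c g. \<phi> g \<in> vec.span B \<and> u = \<pi> (mpoly_const c * f0 + g)"
      then obtain c g where cg: "\<phi> g \<in> vec.span B" "u = \<pi> (mpoly_const c * f0 + g)" by blast
      then have "\<phi> (mpoly_const c * f0 + g) - c *s v \<in> vec.span B"
        by (simp add: \<phi>_add \<phi>_scale f0)
      then show "u \<in> \<pi> ` {f. \<phi> f \<in> vec.span (insert v B)}"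
        unfolding cg(2) vec.span_insert by blast
    next
      assume "u \<in> \<pi> ` {f. \<phi> f \<in> vec.span (insert v B)}"
      then obtain f k where fk: "u = \<pi> f" "\<phi> f - k *s v \<in> vec.span B"
        by (auto simp: vec.span_insert)
      then show "\<exists>c g. \<phi> g \<in> vec.span B \<and> u = \<pi> (mpoly_const c * f0 + g)"
        by (intro exI[of _ k] exI[of _ "f - mpoly_const k * f0"]) (auto simp: \<phi>_diff \<phi>_scale f0)
    qed
    ultimately show ?thesis by blast
  qed
  finally show ?case using insert.hyps by simp
qed

lemma dimension_image:
  assumes "vec.subspace (\<phi> ` W)"
  shows "Q.dimension (vec.dim (\<phi> ` W)) (quot_consts I) (\<pi> ` W)"
proof -
  obtain B where B: "B \<subseteq> \<phi> ` W" "vec.independent B" "\<phi> ` W \<subseteq> vec.span B" "card B = vec.dim (\<phi> ` W)"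
    by (rule vec.basis_exists)
  have "vec.span B = \<phi> ` W"
    using B(1,3) vec.span_minimal[OF B(1) assms] by blast
  then have "\<pi> ` {f. \<phi> f \<in> vec.span B} = \<pi> ` W"
    by (auto simp: image_iff \<pi>_eq_iff)
  moreover have "B \<subseteq> range \<phi>" using B(1) by blast
  ultimately show ?thesis
    using dimension_span[OF vec.finiteI_independent[OF B(2)] B(2)] B(4) by simp
qed

text \<open>
  Dimensions over the image of the constants are unique only when that image is a field, that is, when \<open>I\<close> is proper.
\<close>

lemma subfield_quot_consts:
  assumes "\<phi> 1 \<noteq> 0"
  shows "subfield (quot_consts I) Q"
proof -
  let ?L = "ring_of_type_algebra :: 'l ring"
  interpret L: field ?L by (rule field_from_type_algebra)
  have "(\<lambda>c. \<pi> (mpoly_const c)) \<in> ring_hom ?L Q"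
    by (rule ring_hom_memI)
      (simp_all add: ring_of_type_algebra_def[where 'a = 'l] \<pi>_ops mpoly_const_simps \<pi>_one)
  then interpret h: ring_hom_ring ?L Q "\<lambda>c. \<pi> (mpoly_const c)"
    by (rule ring_hom_ringI2[OF L.ring_axioms Q.ring_axioms])
  have "\<one>\<^bsub>Q\<^esub> \<noteq> \<zero>\<^bsub>Q\<^esub>"
    using assms \<phi>_zero unfolding \<pi>_one[symmetric] \<pi>_zero[symmetric] \<pi>_eq_iff by simp
  from h.img_is_subfield(2)[OF L.carrier_is_subfield this]
  show ?thesis by (simp add: quot_consts_eq ring_of_type_algebra_def[where 'a = 'l])
qed

lemma affine_HF_eq_dim:
  assumes "\<phi> 1 \<noteq> 0" and "vec.subspace (\<phi> ` mpolys_upto i)"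
  shows "affine_HF I i = vec.dim (\<phi> ` mpolys_upto i)"
  using Q.dimI[OF subfield_quot_consts[OF assms(1)] dimension_image[OF assms(2)]]
  by (simp add: affine_HF_def over_def \<pi>_def[abs_def])

end

section \<open>Standard terms\<close>

lemma tdeg_alt: "tdeg (s :: 'n::finite pterm) = (\<Sum>x\<in>UNIV. Poly_Mapping.lookup s x)"
  unfolding tdeg_def by (rule sum.mono_neutral_left) (auto simp: in_keys_iff)

lemma tdeg_add: "tdeg (s + u :: 'n::finite pterm) = tdeg s + tdeg u"
  by (simp add: tdeg_alt lookup_add sum.distrib)

lemma tdeg_zero [simp]: "tdeg 0 = 0"
  by (simp add: tdeg_def)

lemma tdeg_var [simp]: "tdeg (var_term x) = 1"
  by (simp add: tdeg_def var_term_def)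

lemma finite_terms_upto: "finite {s :: 'n::finite pterm. tdeg s \<le> i}"
proof (rule finite_imageD)
  have "Poly_Mapping.lookup s x \<le> tdeg s" for s :: "'n pterm" and x
    unfolding tdeg_alt by (rule member_le_sum) auto
  then have "Poly_Mapping.lookup ` {s :: 'n pterm. tdeg s \<le> i} \<subseteq> UNIV \<rightarrow>\<^sub>E {..i}"
    by (auto simp: PiE_UNIV_domain intro: order_trans)
  then show "finite (Poly_Mapping.lookup ` {s :: 'n pterm. tdeg s \<le> i})"
    by (rule finite_subset) (auto intro: finite_PiE)
  show "inj_on Poly_Mapping.lookup {s :: 'n pterm. tdeg s \<le> i}"
    by (intro inj_onI poly_mapping_eqI) simp
qed

text \<open>
  A term order refining the degree, given by a key in a linearly ordered monoid: the exponent vector,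
  preceded by the total degree as the entry that is compared first.
\<close>

lemma exists_degree_compatible_order:
  "\<exists>\<kappa> :: 'n::finite pterm \<Rightarrow> (nat \<Rightarrow>\<^sub>0 nat). inj \<kappa> \<and> (\<forall>s u. \<kappa> (s + u) = \<kappa> s + \<kappa> u) \<and>
    (\<forall>s u. tdeg s < tdeg u \<longrightarrow> \<kappa> s < \<kappa> u)"
proof -
  obtain e :: "'n \<Rightarrow> nat" where e: "inj e"
    using finite_imp_inj_to_nat_seg[of "UNIV :: 'n set"] by auto
  define \<kappa> :: "'n pterm \<Rightarrow> (nat \<Rightarrow>\<^sub>0 nat)" where
    "\<kappa> s = Poly_Mapping.single 0 (tdeg s) + (\<Sum>x\<in>UNIV. Poly_Mapping.single (Suc (e x)) (Poly_Mapping.lookup s x))" for s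
  have key_zero: "Poly_Mapping.lookup (\<kappa> s) 0 = tdeg s" for s
    by (simp add: \<kappa>_def lookup_add lookup_sum lookup_single)
  have key_Suc: "Poly_Mapping.lookup (\<kappa> s) (Suc (e x)) = Poly_Mapping.lookup s x" for s x
    using e by (simp add: \<kappa>_def lookup_add lookup_sum lookup_single when_def inj_eq)
  have "inj \<kappa>"
    by (rule injI, rule poly_mapping_eqI) (metis key_Suc)
  moreover have "\<kappa> (s + u) = \<kappa> s + \<kappa> u" for s u
    by (simp add: \<kappa>_def tdeg_add lookup_add single_add sum.distrib algebra_simps)
  moreover have "\<kappa> s < \<kappa> u" if "tdeg s < tdeg u" for s u
    using that by (auto simp: less_poly_mapping.rep_eq less_fun_def key_zero intro!: exI[of _ 0])
  ultimately show ?thesis by blast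
qed

context linear_quotient
begin

lemma image_terms_eq_span:
  "\<phi> ` {g. Poly_Mapping.keys g \<subseteq> T} = vec.span ((\<lambda>s. \<phi> (Poly_Mapping.single s 1)) ` T)" (is "?L = ?R")
proof
  show "?L \<subseteq> ?R"
  proof clarify
    fix g :: "('x, 'l) mpoly" assume T: "Poly_Mapping.keys g \<subseteq> T"
    show "\<phi> g \<in> ?R"
    proof (induction g rule: mpoly_induct)
      case (monomial s c)
      have "\<phi> (Poly_Mapping.single s c) = c *s \<phi> (Poly_Mapping.single s 1)"
        by (simp add: mpoly_const_def mult_single flip: \<phi>_scale)
      then show ?case using monomial T by (cases "c = 0") (auto simp: vec.span_zero intro: vec.span_scale vec.span_base)
    qed (auto simp: \<phi>_zero \<phi>_add intro: vec.span_zero vec.span_add)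
  qed
  have "vec.subspace ?L"
  proof (rule vec.subspaceI)
    show "0 \<in> ?L" by (rule image_eqI[of _ _ 0]) (auto simp: \<phi>_zero)
    show "x + y \<in> ?L" if "x \<in> ?L" "y \<in> ?L" for x y
    proof -
      from that obtain f g where "x = \<phi> f" "y = \<phi> g" "Poly_Mapping.keys f \<subseteq> T" "Poly_Mapping.keys g \<subseteq> T" by auto
      then show ?thesis using keys_add[of f g] by (intro image_eqI[of _ _ "f + g"]) (auto simp: \<phi>_add)
    qed
    show "c *s x \<in> ?L" if "x \<in> ?L" for c x
    proof -
      from that obtain f where "x = \<phi> f" "Poly_Mapping.keys f \<subseteq> T" by auto
      moreover have "Poly_Mapping.keys (mpoly_const c * f) \<subseteq> Poly_Mapping.keys f"
        using keys_mult[of "mpoly_const c" f] by (auto simp: mpoly_const_def split: if_splits)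
      ultimately show ?thesis by (intro image_eqI[of _ _ "mpoly_const c * f"]) (auto simp: \<phi>_scale)
    qed
  qed
  then show "?R \<subseteq> ?L"
    by (intro vec.span_minimal) (auto intro!: imageI)
qed

lemma subspace_image_mpolys_upto: "vec.subspace (\<phi> ` mpolys_upto i)"
  using image_terms_eq_span[of "{s. tdeg s \<le> i}"]
  by (simp add: mpolys_upto_def subset_iff Ball_def)

end

locale standard_terms = linear_quotient \<phi>
  for \<phi> :: "('x::finite, 'l::field) mpoly \<Rightarrow> 'l ^ 'm::finite" +
  fixes \<kappa> :: "'x pterm \<Rightarrow> (nat \<Rightarrow>\<^sub>0 nat)"
  assumes inj_\<kappa>: "inj \<kappa>" and \<kappa>_add: "\<And>s u. \<kappa> (s + u) = \<kappa> s + \<kappa> u"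
    and \<kappa>_degree: "\<And>s u. tdeg s < tdeg u \<Longrightarrow> \<kappa> s < \<kappa> u"
begin

definition "term_image s = \<phi> (Poly_Mapping.single s 1)"
text \<open>
  The terms that are not leading terms of elements of the kernel.
\<close>

definition "Std = {s. term_image s \<notin> vec.span (term_image ` {u. \<kappa> u < \<kappa> s})}"

text \<open>
  A relation expressing \<open>u\<close> by smaller terms can be multiplied by \<open>v\<close>, since the kernel is an
  ideal and the order is compatible with products.
\<close>

lemma Std_divisor:
  assumes "u + v \<in> Std"
  shows "u \<in> Std"
proof (rule ccontr)
  assume "u \<notin> Std"
  then obtain g where g: "Poly_Mapping.keys g \<subseteq> {a. \<kappa> a < \<kappa> u}" "term_image u = \<phi> g"
    unfolding Std_def term_image_def[abs_def] by (auto simp flip: image_terms_eq_span)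
  have "\<phi> (Poly_Mapping.single v 1 * (Poly_Mapping.single u 1 - g)) = 0"
    using I.I_l_closed[of "Poly_Mapping.single u 1 - g" "Poly_Mapping.single v 1"] g(2)
    by (simp add: I_def \<phi>_diff term_image_def)
  then have "term_image (u + v) = \<phi> (Poly_Mapping.single v 1 * g)"
    by (simp add: right_diff_distrib \<phi>_diff mult_single term_image_def add.commute)
  moreover have "Poly_Mapping.keys (Poly_Mapping.single v 1 * g) \<subseteq> {a. \<kappa> a < \<kappa> (u + v)}"
    using keys_mult[of "Poly_Mapping.single v 1" g] g(1) by (force simp: \<kappa>_add add.commute)
  ultimately have "term_image (u + v) \<in> vec.span (term_image ` {a. \<kappa> a < \<kappa> (u + v)})"
    unfolding term_image_def[abs_def] by (auto simp flip: image_terms_eq_span)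
  then show False using assms by (simp add: Std_def)
qed

lemma lower_subset: "{u. \<kappa> u \<le> \<kappa> s} \<subseteq> {u. tdeg u \<le> tdeg s}"
  using \<kappa>_degree[of s] by (auto simp: not_le[symmetric])

lemma in_span_Std: "term_image s \<in> vec.span (term_image ` {u \<in> Std. \<kappa> u \<le> \<kappa> s})"
proof (induction "card {u. \<kappa> u < \<kappa> s}" arbitrary: s rule: less_induct)
  case less
  show ?case
  proof (cases "s \<in> Std")
    case True
    then show ?thesis by (intro vec.span_base imageI) auto
  next
    case False
    have "term_image u \<in> vec.span (term_image ` {u \<in> Std. \<kappa> u \<le> \<kappa> s})" if u: "\<kappa> u < \<kappa> s" for u
    proof -
      have "finite {u. \<kappa> u < \<kappa> s}"
        by (rule finite_subset[OF _ finite_terms_upto[of "tdeg s"]]) (use lower_subset[of s] less_imp_le in blast)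
      then have "card {a. \<kappa> a < \<kappa> u} < card {a. \<kappa> a < \<kappa> s}"
        using u by (intro psubset_card_mono) auto
      from less.hyps[OF this] show ?thesis
        by (rule set_mp[OF vec.span_mono, rotated]) (use u in auto)
    qed
    then have "vec.span (term_image ` {u. \<kappa> u < \<kappa> s}) \<subseteq> vec.span (term_image ` {u \<in> Std. \<kappa> u \<le> \<kappa> s})"
      by (intro vec.span_minimal vec.subspace_span) auto
    then show ?thesis using False by (auto simp: Std_def)
  qed
qed

lemma span_Std_upto: "vec.span (term_image ` {s \<in> Std. tdeg s \<le> i}) = vec.span (term_image ` {s. tdeg s \<le> i})"
proof
  show "vec.span (term_image ` {s \<in> Std. tdeg s \<le> i}) \<subseteq> vec.span (term_image ` {s. tdeg s \<le> i})"
    by (intro vec.span_mono) auto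
  have "term_image s \<in> vec.span (term_image ` {s \<in> Std. tdeg s \<le> i})" if "tdeg s \<le> i" for s
    using in_span_Std[of s]
    by (rule set_mp[OF vec.span_mono, rotated]) (use that lower_subset[of s] in auto)
  then show "vec.span (term_image ` {s. tdeg s \<le> i}) \<subseteq> vec.span (term_image ` {s \<in> Std. tdeg s \<le> i})"
    by (intro vec.span_minimal vec.subspace_span) auto
qed

lemma span_Std: "vec.span (term_image ` Std) = range \<phi>"
proof -
  have "term_image s \<in> vec.span (term_image ` Std)" for s
    using in_span_Std[of s] by (rule set_mp[OF vec.span_mono, rotated]) auto
  then have "vec.span (term_image ` UNIV) \<subseteq> vec.span (term_image ` Std)"
    by (intro vec.span_minimal vec.subspace_span) auto
  moreover have "vec.span (term_image ` Std) \<subseteq> vec.span (term_image ` UNIV)"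
    by (intro vec.span_mono) auto
  ultimately have "vec.span (term_image ` Std) = vec.span (term_image ` UNIV)" by blast
  then show ?thesis using image_terms_eq_span[of UNIV] by (simp add: term_image_def[abs_def])
qed

lemma independent_Std:
  assumes "finite F" "F \<subseteq> Std"
  shows "vec.independent (term_image ` F) \<and> inj_on term_image F"
  using assms
proof (induction F rule: finite_ranking_induct[where f = \<kappa>])
  case (insert s F)
  show ?case
  proof (cases "s \<in> F")
    case True
    then show ?thesis using insert by (simp add: insert_absorb)
  next
    case False
    have "\<kappa> u < \<kappa> s" if "u \<in> F" for u
      using insert.hyps(2)[OF that] False that inj_\<kappa> by (metis injD order_le_less)
    then have "vec.span (term_image ` F) \<subseteq> vec.span (term_image ` {u. \<kappa> u < \<kappa> s})"
      by (intro vec.span_mono) auto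
    then have "term_image s \<notin> vec.span (term_image ` F)" using insert.prems by (auto simp: Std_def)
    moreover from this have "term_image s \<notin> term_image ` F" using vec.span_base by blast
    ultimately show ?thesis using insert by (auto simp: vec.independent_insert)
  qed
qed (simp add: vec.independent_empty)

lemma finite_Std: "finite Std"
proof (rule ccontr)
  assume "infinite Std"
  then obtain F where F: "F \<subseteq> Std" "finite F" "card F = Suc CARD('m)"
    using infinite_arbitrarily_large by blast
  have "card (term_image ` F) \<le> vec.dim (UNIV :: ('l ^ 'm) set)"
    using independent_Std[OF F(2,1)] by (intro vec.independent_card_le_dim) auto
  then show False using independent_Std[OF F(2,1)] F(3) by (simp add: card_image card_cart_basis)
qed

text \<open>
  Because the order refines the degree, a term of degree at most \<open>i\<close> is reduced to standard terms
  of degree at most \<open>i\<close> as well. Counting standard terms therefore gives the affine Hilbert function.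
\<close>

lemma card_Std_upto: "card {s \<in> Std. tdeg s \<le> i} = vec.dim (\<phi> ` mpolys_upto i)"
proof -
  let ?F = "{s \<in> Std. tdeg s \<le> i}"
  have "finite ?F" "?F \<subseteq> Std" using finite_Std by auto
  note ind = independent_Std[OF this]
  have "vec.dim (\<phi> ` mpolys_upto i) = vec.dim (vec.span (term_image ` ?F))"
    using image_terms_eq_span[of "{s. tdeg s \<le> i}"] unfolding span_Std_upto
    by (simp add: mpolys_upto_def subset_iff Ball_def term_image_def[abs_def])
  also have "\<dots> = card ?F"
    using ind by (simp add: vec.dim_eq_card_independent card_image)
  finally show ?thesis by simp
qed

lemma card_Std:
  assumes "range \<phi> = UNIV"
  shows "card Std = CARD('m)"
proof -
  note ind = independent_Std[OF finite_Std subset_refl]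
  have "CARD('m) = vec.dim (vec.span (term_image ` Std))"
    unfolding span_Std assms by (rule vec_dim_card[symmetric])
  also have "\<dots> = card Std"
    using ind by (simp add: vec.dim_eq_card_independent card_image)
  finally show ?thesis by simp
qed

end

text \<open>
  Over any field, the monomial ideal spanned by the terms outside a divisor-closed set has the
  terms in this set as a basis of the quotient, degree by degree.
\<close>

lemma admissible_of_complement:
  fixes S :: "'n::finite pterm set"
  assumes "bij_betw \<beta> (UNIV :: 'm::finite set) S" and divisor: "\<And>u v. u + v \<in> S \<Longrightarrow> u \<in> S"
  shows "admissible TYPE('k::field) TYPE('n) CARD('m) (\<lambda>i. card {s \<in> S. tdeg s \<le> i})"
proof -
  define \<phi> :: "('n, 'k) mpoly \<Rightarrow> 'k ^ 'm" where "\<phi> f = (\<chi> j. Poly_Mapping.lookup f (\<beta> j))" for f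
  have kernel: "{f. \<phi> f = 0} = {f. Poly_Mapping.keys f \<inter> S = {}}"
    using assms(1) by (auto simp: \<phi>_def vec_eq_iff in_keys_iff bij_betw_def)
  have mult: "Poly_Mapping.keys (g * f) \<inter> S = {}" if f: "Poly_Mapping.keys f \<inter> S = {}" for f g :: "('n, 'k) mpoly"
  proof (rule ccontr)
    assume "Poly_Mapping.keys (g * f) \<inter> S \<noteq> {}"
    then obtain a c where "a + c \<in> S" "c \<in> Poly_Mapping.keys f"
      using keys_mult[of g f] by blast
    then show False using divisor[of c a] f by (auto simp: add.commute)
  qed
  have "ideal {f. \<phi> f = 0} mpoly_ring"
    unfolding kernel
  proof (rule ideal_mpoly_ringI)
    fix f g :: "('n, 'k) mpoly"
    assume "f \<in> {f. Poly_Mapping.keys f \<inter> S = {}}" "g \<in> {f. Poly_Mapping.keys f \<inter> S = {}}"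
    then show "f + g \<in> {f. Poly_Mapping.keys f \<inter> S = {}}" using keys_add[of f g] by blast
  qed (use mult in auto)
  moreover have "\<phi> (mpoly_const c * f) = c *s \<phi> f" for c f
    by (simp add: \<phi>_def vec_eq_iff mpoly_const_def flip: mult_map_scale_conv_mult)
      (simp add: Poly_Mapping.map.rep_eq when_def)
  ultimately interpret linear_quotient \<phi>
    by (intro linear_quotient.intro) (simp_all add: \<phi>_def vec_eq_iff lookup_add)
  have "S \<noteq> {}" using assms(1) by (auto simp: bij_betw_def)
  then have "0 \<in> S" using divisor[of 0] by auto
  then have "1 \<notin> {f. \<phi> f = 0}" unfolding kernel by simp
  then have one: "\<phi> 1 \<noteq> 0" by simp
  have surj: "\<phi> (\<Sum>j\<in>UNIV. Poly_Mapping.single (\<beta> j) (v $ j)) = v" for v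
    using bij_betw_imp_inj_on[OF assms(1)]
    by (simp add: \<phi>_def vec_eq_iff lookup_sum lookup_single when_def inj_eq)
  have "\<phi> ` UNIV = UNIV" 
    by (rule surjI[where f = "\<lambda>v :: 'k ^ 'm. \<Sum>j\<in>UNIV. Poly_Mapping.single (\<beta> j) (v $ j)"]) (rule surj)
  then have "Q.dimension CARD('m) (quot_consts I) (\<pi> ` UNIV)"
    using dimension_image[of UNIV] by (simp add: card_cart_basis)
  moreover have "\<pi> ` UNIV = carrier Q"
    by (auto simp: FactRing_def A_RCOSETS_def' \<pi>_def)
  moreover have "affine_HF I i = card {s \<in> S. tdeg s \<le> i}" for i
  proof -
    let ?D = "{j. tdeg (\<beta> j) \<le> i}"
    have "\<phi> ` mpolys_upto i = {v. \<forall>j. j \<notin> ?D \<longrightarrow> v $ j = 0}"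
    proof (intro equalityI subsetI)
      fix v :: "'k ^ 'm"
      assume v: "v \<in> {v. \<forall>j. j \<notin> ?D \<longrightarrow> v $ j = 0}"
      have "tdeg s \<le> i" if "s \<in> Poly_Mapping.keys (\<Sum>j\<in>UNIV. Poly_Mapping.single (\<beta> j) (v $ j))" for s
      proof -
        from that have "(\<Sum>j\<in>UNIV. Poly_Mapping.lookup (Poly_Mapping.single (\<beta> j) (v $ j)) s) \<noteq> 0"
          by (simp add: in_keys_iff lookup_sum)
        then obtain j where "Poly_Mapping.lookup (Poly_Mapping.single (\<beta> j) (v $ j)) s \<noteq> 0"
          by (rule sum.not_neutral_contains_not_neutral)
        then have "s = \<beta> j" "v $ j \<noteq> 0" by (simp_all add: lookup_single when_def split: if_splits)
        then show ?thesis using v by auto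
      qed
      then have "(\<Sum>j\<in>UNIV. Poly_Mapping.single (\<beta> j) (v $ j)) \<in> mpolys_upto i"
        unfolding mpolys_upto_def by blast
      then show "v \<in> \<phi> ` mpolys_upto i" by (rule image_eqI[rotated]) (simp only: surj)
    qed (auto simp: \<phi>_def mpolys_upto_def in_keys_iff)
    then have "vec.dim (\<phi> ` mpolys_upto i) = card ?D"
      by (simp only: dim_substandard_cart)
    also have "\<dots> = card (\<beta> ` ?D)"
      using bij_betw_imp_inj_on[OF assms(1)] by (intro card_image[symmetric]) (auto simp: inj_on_def)
    also have "\<beta> ` ?D = {s \<in> S. tdeg s \<le> i}"
      using assms(1) by (auto simp: bij_betw_def)
    finally show ?thesis using affine_HF_eq_dim[OF one subspace_image_mpolys_upto] by simp
  qed
  ultimately show ?thesis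
    unfolding admissible_def using I.ideal_axioms
    by (intro exI[of _ I]) auto
qed

text \<open>
  Admissibility does not depend on the field: the standard terms of an ideal over \<open>L\<close> define a monomial ideal over
  \<open>K\<close> with the same affine Hilbert function.
\<close>

lemma (in standard_terms) admissible_affine_HF:
  assumes "\<phi> 1 \<noteq> 0" "range \<phi> = UNIV"
  shows "admissible TYPE('k::field) TYPE('x) CARD('m) (affine_HF I)"
proof -
  obtain \<beta> where "bij_betw \<beta> (UNIV :: 'm set) Std"
    using finite_same_card_bij[of "UNIV :: 'm set" Std] finite_Std card_Std[OF assms(2)] by auto
  moreover have "affine_HF I = (\<lambda>i. card {s \<in> Std. tdeg s \<le> i})"
    using affine_HF_eq_dim[OF assms(1) subspace_image_mpolys_upto] card_Std_upto by auto
  ultimately show ?thesis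
    using admissible_of_complement[of \<beta> Std] Std_divisor by simp
qed

section \<open>Fibers over geometric points\<close>

lemma term_induct [case_names zero var]:
  fixes s :: "'n::finite pterm"
  assumes "P 0" "\<And>r s. P s \<Longrightarrow> P (var_term r + s)"
  shows "P s"
proof (induction "tdeg s" arbitrary: s rule: less_induct)
  case less
  show ?case
  proof (cases "s = 0")
    case True
    then show ?thesis using assms(1) by simp
  next
    case False
    then obtain r where r: "Poly_Mapping.lookup s r > 0"
      by (metis gr0I lookup_zero poly_mapping_eqI)
    define s' where "s' = s - var_term r"
    have s: "s = var_term r + s'"
      using r by (intro poly_mapping_eqI) (auto simp: s'_def lookup_add lookup_minus var_term_def lookup_single when_def)
    then have "tdeg s' < tdeg s" by (simp add: s tdeg_add)
    then show ?thesis using less assms(2) s by metis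
  qed
qed

text \<open>
  Commuting operators make a set into a module over the monoid of terms. The orbit map is built by
  applying the operators in some fixed order, and commutativity makes that order irrelevant.
\<close>

lemma exists_orbit_map:
  fixes F :: "'n::finite \<Rightarrow> 'a \<Rightarrow> 'a"
  assumes comm: "\<And>r q y. F r (F q y) = F q (F r y)"
  shows "\<exists>w :: 'n pterm \<Rightarrow> 'a. w 0 = x \<and> (\<forall>r s. w (var_term r + s) = F r (w s))"
proof -
  obtain xs where xs: "set xs = (UNIV :: 'n set)" "distinct xs"
    using finite_distinct_list[of "UNIV :: 'n set"] by auto
  define go where "go s ys = foldr (\<lambda>r. F r ^^ Poly_Mapping.lookup s r) ys x" for s ys
  have comm_pow: "(F q ^^ k) (F r y) = F r ((F q ^^ k) y)" for q r k y
    by (induction k) (auto simp: comm)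
  have "go (var_term r + s) ys = (if r \<in> set ys then F r (go s ys) else go s ys)" if "distinct ys" for r s ys
    using that
    by (induction ys) (auto simp: go_def lookup_add var_term_def lookup_single when_def comm_pow)
  then have "go (var_term r + s) xs = F r (go s xs)" for r s using xs by simp
  moreover have "go 0 ys = x" for ys by (induction ys) (auto simp: go_def)
  ultimately show ?thesis by (intro exI[of _ "\<lambda>s. go s xs"]) auto
qed

definition mult_matrix ::
  "('m::finite \<Rightarrow> 'n pterm) \<Rightarrow> ('v \<Rightarrow> 'n pterm) \<Rightarrow> ('m \<times> 'v \<Rightarrow> 'l::field) \<Rightarrow> 'n \<Rightarrow> 'l ^ 'm ^ 'm"
  where "mult_matrix t b \<Gamma> r =
    (\<chi> i j. if var_term r + t j \<in> range t
             then (if var_term r + t j = t i then 1 else 0)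
             else \<Gamma> (i, THE m. var_term r + t j = b m))"

locale border_basis =
  fixes t :: "'m::finite \<Rightarrow> 'n::finite pterm" and b :: "'v::finite \<Rightarrow> 'n pterm"
  assumes inj_t: "inj t" and order_ideal: "order_ideal (range t)"
    and bij_b: "bij_betw b UNIV (border (range t))"
begin

definition "i0 = (THE i. t i = 0)"

lemma t_i0: "t i0 = 0"
proof -
  obtain j where "0 + t j \<in> range t" by simp
  then obtain i where "t i = 0" using order_ideal unfolding order_ideal_def by (metis rangeE)
  then show ?thesis unfolding i0_def by (rule theI) (metis \<open>t i = 0\<close> inj_t injD)
qed

lemma border_index:
  assumes "var_term r + t j \<notin> range t"
  shows "b (THE m. var_term r + t j = b m) = var_term r + t j"
proof -
  have "var_term r + t j \<in> border (range t)"
    using assms by (auto simp: border_def)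
  then obtain m where m: "var_term r + t j = b m" using bij_b by (auto simp: bij_betw_def)
  have "(THE m. var_term r + t j = b m) = m"
    using m bij_b by (intro the_equality) (auto simp: bij_betw_def inj_def)
  then show ?thesis using m by simp
qed

lemma border_cases: "\<exists>r j. b m = var_term r + t j" "b m \<notin> range t"
proof -
  have "b m \<in> border (range t)" using bij_b by (auto simp: bij_betw_def)
  then show "\<exists>r j. b m = var_term r + t j" "b m \<notin> range t" by (auto simp: border_def)
qed

lemma inj_b: "b m = b m' \<longleftrightarrow> m = m'"
  using bij_b by (auto simp: bij_betw_def inj_def)

end

locale border_basis_point = border_basis t b
  for t :: "'m::finite \<Rightarrow> 'n::finite pterm" and b :: "'v::finite \<Rightarrow> 'n pterm" +
  fixes \<Gamma> :: "'m \<times> 'v \<Rightarrow> 'l::field"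
  assumes commute: "mult_matrix t b \<Gamma> r ** mult_matrix t b \<Gamma> s = mult_matrix t b \<Gamma> s ** mult_matrix t b \<Gamma> r"
begin

abbreviation "M \<equiv> mult_matrix t b \<Gamma>"

lemma exists_term_vec: "\<exists>w. w 0 = axis i0 1 \<and> (\<forall>r s. w (var_term r + s) = M r *v w s)"
  by (rule exists_orbit_map) (simp add: matrix_vector_mul_assoc commute)

definition "term_vec = (SOME w. w 0 = axis i0 1 \<and> (\<forall>r s. w (var_term r + s) = M r *v w s))"

lemma term_vec_zero: "term_vec 0 = axis i0 1"
  and term_vec_var: "term_vec (var_term r + s) = M r *v term_vec s"
  using someI_ex[OF exists_term_vec, folded term_vec_def] by auto

lemma M_axis: "M r *v axis j 1 = (\<chi> i. M r $ i $ j)"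
  by (simp add: matrix_vector_mult_def vec_eq_iff axis_def if_distrib[of "\<lambda>x. _ * x"] cong: if_cong)

text \<open>
  A divisor-closed set allows the vector of \<open>t j\<close> to be reached from the vector of \<open>1\<close> without leaving the
  order ideal, where the multiplication matrices send unit vectors to unit vectors.
\<close>

lemma term_vec_t: "term_vec (t j) = axis j 1"
proof -
  have "\<forall>j. t j = s \<longrightarrow> term_vec s = axis j 1" for s
  proof (induction s rule: term_induct)
    case zero
    show ?case using t_i0 inj_t by (metis injD term_vec_zero)
  next
    case (var r s)
    show ?case
    proof (intro allI impI)
      fix j assume j: "t j = var_term r + s"
      then have "s + var_term r \<in> range t" by (metis add.commute rangeI)
      then obtain k where k: "s = t k" using order_ideal unfolding order_ideal_def by (metis rangeE)
      then have "term_vec s = axis k 1" using var by simp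
      then have "term_vec (var_term r + s) = (\<chi> i. M r $ i $ k)"
        by (simp add: term_vec_var M_axis)
      also have "\<dots> = axis j 1"
        using j inj_t by (auto simp: vec_eq_iff mult_matrix_def axis_def inj_eq k[symmetric] simp flip: j)
      finally show "term_vec (var_term r + s) = axis j 1" .
    qed
  qed
  then show ?thesis by blast
qed

lemma term_vec_b: "term_vec (b m) = (\<chi> i. \<Gamma> (i, m))"
proof -
  obtain r j where rj: "b m = var_term r + t j" using border_cases by blast
  then have out: "var_term r + t j \<notin> range t" using border_cases by metis
  have "(THE m. var_term r + t j = b m) = m" using border_index[OF out] rj inj_b by metis
  then show ?thesis unfolding rj using out
    by (simp only: term_vec_var term_vec_t M_axis) (simp add: mult_matrix_def)
qed

text \<open>
  The action of a polynomial on the vector of \<open>1\<close> by substituting the multiplication matrices.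
\<close>

definition eval_vec :: "('n, 'l) mpoly \<Rightarrow> 'l ^ 'm"
  where "eval_vec f = (\<Sum>s\<in>Poly_Mapping.keys f. Poly_Mapping.lookup f s *s term_vec s)"

lemma eval_vec_superset:
  assumes "finite S" "Poly_Mapping.keys f \<subseteq> S"
  shows "eval_vec f = (\<Sum>s\<in>S. Poly_Mapping.lookup f s *s term_vec s)"
  unfolding eval_vec_def using assms
  by (intro sum.mono_neutral_left) (auto simp: in_keys_iff)

lemma eval_vec_single: "eval_vec (Poly_Mapping.single s c) = c *s term_vec s"
  by (subst eval_vec_superset[of "{s}"]) auto

lemma eval_vec_zero: "eval_vec 0 = 0" by (simp add: eval_vec_def)

lemma eval_vec_add: "eval_vec (f + g) = eval_vec f + eval_vec g"
  using keys_add[of f g]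
  by (simp add: eval_vec_superset[of "Poly_Mapping.keys f \<union> Poly_Mapping.keys g"] lookup_add
      vec.scale_left_distrib sum.distrib)

lemma eval_vec_const: "eval_vec (mpoly_const c * f) = c *s eval_vec f"
  by (induction f rule: mpoly_induct)
    (auto simp: mpoly_const_def mult_single eval_vec_single eval_vec_add distrib_left
      vec.scale_right_distrib eval_vec_zero)

lemma eval_vec_var: "eval_vec (Poly_Mapping.single (var_term r) 1 * f) = M r *v eval_vec f"
  by (induction f rule: mpoly_induct)
    (auto simp: mult_single eval_vec_single eval_vec_add distrib_left
      matrix_vector_right_distrib eval_vec_zero term_vec_var vector_scalar_commute)

lemma eval_vec_mult_zero:
  assumes "eval_vec f = 0"
  shows "eval_vec (g * f) = 0"
proof (induction g rule: mpoly_induct)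
  case (monomial s c)
  show ?case
  proof (induction s rule: term_induct)
    case zero
    then show ?case using eval_vec_const[of c f] assms by (simp add: mpoly_const_def)
  next
    case (var r s)
    have "Poly_Mapping.single (var_term r + s) c * f
        = Poly_Mapping.single (var_term r) 1 * (Poly_Mapping.single s c * f)"
      by (simp add: mult_single flip: mult.assoc)
    then show ?case using var by (simp add: eval_vec_var)
  qed
qed (auto simp: eval_vec_zero distrib_right eval_vec_add)

sublocale linear_quotient eval_vec
  by (intro linear_quotient.intro ideal_mpoly_ringI)
    (auto simp: eval_vec_zero eval_vec_add eval_vec_const eval_vec_mult_zero)

definition "normal_form f = (\<Sum>i\<in>UNIV. mpoly_const (eval_vec f $ i) * Poly_Mapping.single (t i) 1)"

lemma eval_vec_sum: "eval_vec (sum h S) = (\<Sum>i\<in>S. eval_vec (h i))"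
  by (induction S rule: infinite_finite_induct) (auto simp: eval_vec_zero eval_vec_add)

lemma sum_axis: "(\<Sum>i\<in>UNIV. c i *s axis i (1::'l)) = (\<chi> i. c i)"
  by (simp add: vec_eq_iff axis_def if_distrib[of "\<lambda>x. _ * x"] cong: if_cong)

lemma eval_vec_combination:
  "eval_vec (\<Sum>i\<in>UNIV. mpoly_const (c i) * Poly_Mapping.single (t i) 1) = (\<chi> i. c i)"
  by (simp only: eval_vec_sum eval_vec_const eval_vec_single term_vec_t vec.scale_one sum_axis)

lemma range_eval_vec: "range eval_vec = UNIV"
proof (rule surjI)
  fix v :: "'l ^ 'm"
  show "eval_vec (\<Sum>i\<in>UNIV. mpoly_const (v $ i) * Poly_Mapping.single (t i) 1) = v"
    by (simp only: eval_vec_combination vec_lambda_eta)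
qed

text \<open>
  The inclusion of the fiber ideal in the kernel holds because its generators are killed. For the
  converse, every polynomial is congruent to its normal form modulo the fiber ideal: this is clear
  for terms in the order ideal and its border, and a general term is reached by multiplying
  repeatedly by indeterminates and rewriting the border terms.
\<close>

lemma fiber_ideal_eq_kernel: "border_basis_fiber_ideal t b \<Gamma> = I"
proof -
  note ring = ring_from_type_algebra[where 'a = "('n, 'l) mpoly"]
  define gen where "gen m = Poly_Mapping.single (b m) 1
      - (\<Sum>i\<in>UNIV. mpoly_const (\<Gamma> (i, m)) * Poly_Mapping.single (t i) 1)" for m
  define J where "J = border_basis_fiber_ideal t b \<Gamma>"
  have J_alt: "J = Idl\<^bsub>mpoly_ring\<^esub> {gen m | m. True}"
    by (simp add: J_def border_basis_fiber_ideal_def gen_def)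
  interpret J: ideal J mpoly_ring
    unfolding J_alt by (rule ring.genideal_ideal[OF ring]) simp
  have gen_J: "gen m \<in> J" for m
    unfolding J_alt using ring.genideal_self[OF ring, of "{gen m | m. True}"] by auto
  have J_zero: "0 \<in> J" using additive_subgroup.zero_closed[OF J.is_additive_subgroup] by simp
  have J_add: "f + g \<in> J" if "f \<in> J" "g \<in> J" for f g
    using additive_subgroup.a_closed[OF J.is_additive_subgroup] that by simp
  have J_mult: "g * f \<in> J" if "f \<in> J" for f g
    using J.I_l_closed[OF that, of g] by simp
  have J_diff: "f - g \<in> J" if "f \<in> J" "g \<in> J" for f g
    using J_add[OF that(1) J_mult[OF that(2), of "-1"]] by simp
  have "gen m \<in> I" for m
    by (simp add: I_def gen_def \<phi>_diff eval_vec_single term_vec_b eval_vec_combination)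
  then have J_sub: "J \<subseteq> I"
    unfolding J_alt by (intro ring.genideal_minimal[OF ring] I.ideal_axioms) auto
  have congruent: "f - normal_form f \<in> J" if "g - normal_form g \<in> J" "f - g \<in> J" for f g
  proof -
    have "eval_vec (f - g) = 0" using that(2) J_sub by (auto simp: I_def)
    then have "normal_form f = normal_form g" by (simp add: normal_form_def \<phi>_diff)
    then show ?thesis using J_add[OF that] by simp
  qed
  have nf_zero: "normal_form 0 = 0"
    by (simp add: normal_form_def eval_vec_zero mpoly_const_def)
  have nf_add: "normal_form (f + g) = normal_form f + normal_form g" for f g
    by (simp add: normal_form_def eval_vec_add mpoly_const_def single_add distrib_right sum.distrib)
  have nf_const: "normal_form (mpoly_const c * f) = mpoly_const c * normal_form f" for c f
    by (simp add: normal_form_def eval_vec_const mpoly_const_simps sum_distrib_left mult.assoc)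
  have red_add: "(f + g) - normal_form (f + g) \<in> J"
    if "f - normal_form f \<in> J" "g - normal_form g \<in> J" for f g
    using J_add[OF that] by (simp add: nf_add algebra_simps)
  have red_const: "mpoly_const c * f - normal_form (mpoly_const c * f) \<in> J"
    if "f - normal_form f \<in> J" for c f
    using J_mult[OF that, of "mpoly_const c"] by (simp add: nf_const right_diff_distrib)
  have red_sum: "(\<Sum>i\<in>S. h i) - normal_form (\<Sum>i\<in>S. h i) \<in> J"
    if "\<And>i. h i - normal_form (h i) \<in> J" for h and S :: "'m set"
  proof (induction S rule: infinite_finite_induct)
    case (insert i S)
    show ?case
      unfolding sum.insert[OF insert.hyps] by (rule red_add[OF that insert.IH])
  qed (simp_all add: nf_zero J_zero)
  have red_t: "Poly_Mapping.single (t i) 1 - normal_form (Poly_Mapping.single (t i) 1) \<in> J" for i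
  proof -
    have "normal_form (Poly_Mapping.single (t i) 1) = Poly_Mapping.single (t i) 1"
      by (simp add: normal_form_def eval_vec_single term_vec_t axis_def mpoly_const_def
          if_distrib[of "Poly_Mapping.single 0"] if_distrib[of "\<lambda>x. x * _"] cong: if_cong)
    then show ?thesis using J_zero by simp
  qed
  have red_xt: "Poly_Mapping.single (var_term r + t i) 1
      - normal_form (Poly_Mapping.single (var_term r + t i) 1) \<in> J" for r i
  proof (cases "var_term r + t i \<in> range t")
    case True
    then show ?thesis using red_t by auto
  next
    case False
    then obtain m where "var_term r + t i = b m" using border_index by metis
    then show ?thesis
      using gen_J[of m] by (simp add: gen_def normal_form_def eval_vec_single term_vec_b)
  qed
  have red_term: "Poly_Mapping.single s 1 - normal_form (Poly_Mapping.single s 1) \<in> J" for s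
  proof (induction s rule: term_induct)
    case zero
    show ?case using red_t[of i0] by (simp add: t_i0)
  next
    case (var r s)
    define y where "y = (Poly_Mapping.single (var_term r) 1 :: ('n, 'l) mpoly)"
    define n where "n = normal_form (Poly_Mapping.single s 1)"
    have "y * n = (\<Sum>i\<in>UNIV. mpoly_const (eval_vec (Poly_Mapping.single s 1) $ i)
        * Poly_Mapping.single (var_term r + t i) 1)"
      unfolding y_def n_def normal_form_def sum_distrib_left
      by (intro sum.cong refl) (subst mult.left_commute, simp add: mult_single)
    then have "y * n - normal_form (y * n) \<in> J"
      by (simp only:) (rule red_sum, rule red_const, rule red_xt)
    moreover have "y * Poly_Mapping.single s 1 - y * n \<in> J"
      using J_mult[OF var, of y] by (simp add: n_def right_diff_distrib)
    ultimately have "y * Poly_Mapping.single s 1 - normal_form (y * Poly_Mapping.single s 1) \<in> J"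
      by (rule congruent)
    then show ?case by (simp add: y_def mult_single)
  qed
  have red: "f - normal_form f \<in> J" for f
  proof (induction f rule: mpoly_induct)
    case (monomial s c)
    show ?case using red_const[OF red_term, of c s] by (simp add: mpoly_const_def mult_single)
  qed (auto simp: nf_zero J_zero red_add)
  have "I \<subseteq> J"
  proof
    fix f assume "f \<in> I"
    then have "normal_form f = 0" by (simp add: I_def normal_form_def mpoly_const_def)
    then show "f \<in> J" using red[of f] by simp
  qed
  with J_sub show ?thesis unfolding J_def by blast
qed

lemma eval_vec_one: "eval_vec 1 \<noteq> 0"
  using eval_vec_single[of 0 1] by (simp add: term_vec_zero axis_eq_0_iff)

lemma affine_HF_fiber:
  "affine_HF (border_basis_fiber_ideal t b \<Gamma>) i = vec.dim (term_vec ` {s. tdeg s \<le> i})"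
proof -
  have "eval_vec ` mpolys_upto i = vec.span (term_vec ` {s. tdeg s \<le> i})"
    using image_terms_eq_span[of "{s. tdeg s \<le> i}"]
    by (simp add: mpolys_upto_def subset_iff Ball_def eval_vec_single)
  then show ?thesis
    unfolding fiber_ideal_eq_kernel affine_HF_eq_dim[OF eval_vec_one subspace_image_mpolys_upto]
    by simp
qed

lemma affine_HF_fiber_lower: "order_ideal_HF (range t) \<le> affine_HF (border_basis_fiber_ideal t b \<Gamma>)"
proof (rule le_funI)
  fix i
  let ?J = "{j. tdeg (t j) \<le> i}"
  have "{s \<in> range t. tdeg s \<le> i} = t ` ?J" by auto
  then have "order_ideal_HF (range t) i = card ?J"
    unfolding order_ideal_HF_def using inj_t by (simp add: card_image inj_on_subset)
  also have "\<dots> = card ((\<lambda>j. axis j (1::'l)) ` ?J)"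
    by (intro card_image[symmetric]) (auto simp: inj_on_def axis_eq_axis)
  also have "\<dots> \<le> vec.dim (term_vec ` {s. tdeg s \<le> i})"
  proof (rule vec.independent_card_le_dim)
    show "(\<lambda>j. axis j (1::'l)) ` ?J \<subseteq> term_vec ` {s. tdeg s \<le> i}"
      by (auto simp flip: term_vec_t)
    show "vec.independent ((\<lambda>j. axis j (1::'l)) ` ?J)"
      by (rule vec.independent_mono[OF vec.independent_Basis]) (auto simp: cart_basis_def)
  qed
  finally show "order_ideal_HF (range t) i \<le> affine_HF (border_basis_fiber_ideal t b \<Gamma>) i"
    by (simp add: affine_HF_fiber)
qed

lemma affine_HF_fiber_upper: "affine_HF (border_basis_fiber_ideal t b \<Gamma>) \<le> max_HF TYPE('n) CARD('m)"
proof (rule le_funI)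
  fix i
  have "vec.dim (term_vec ` {s. tdeg s \<le> i}) \<le> card (term_vec ` {s. tdeg s \<le> i})"
    by (rule vec.dim_le_card') (use finite_terms_upto in auto)
  also have "\<dots> \<le> card {s :: 'n pterm. tdeg s \<le> i}"
    by (rule card_image_le[OF finite_terms_upto])
  finally have "vec.dim (term_vec ` {s. tdeg s \<le> i}) \<le> card {s :: 'n pterm. tdeg s \<le> i}" .
  moreover have "vec.dim (term_vec ` {s. tdeg s \<le> i}) \<le> CARD('m)"
    using vec.dim_subset[OF subset_UNIV] by (metis vec_dim_card)
  ultimately show "affine_HF (border_basis_fiber_ideal t b \<Gamma>) i \<le> max_HF TYPE('n) CARD('m) i"
    by (simp add: affine_HF_fiber max_HF_def)
qed

text \<open>
  The standard terms carry the Hilbert function from the field of the point to any other field \<open>K\<close>.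
\<close>

lemma admissible_affine_HF_fiber:
  "admissible TYPE('k::field) TYPE('n) CARD('m) (affine_HF (border_basis_fiber_ideal t b \<Gamma>))"
proof -
  obtain \<kappa> :: "'n pterm \<Rightarrow> (nat \<Rightarrow>\<^sub>0 nat)" where
    "inj \<kappa>" "\<forall>s u. \<kappa> (s + u) = \<kappa> s + \<kappa> u" "\<forall>s u. tdeg s < tdeg u \<longrightarrow> \<kappa> s < \<kappa> u"
    using exists_degree_compatible_order by blast
  then interpret standard_terms eval_vec \<kappa>
    by unfold_locales auto
  show ?thesis
    unfolding fiber_ideal_eq_kernel
    by (rule admissible_affine_HF[OF eval_vec_one range_eval_vec])
qed

end

section \<open>Rank conditions as polynomial equations\<close>

lemma (in unital_hom) hom_det: "\<phi> (det A) = det (\<chi> i j. \<phi> (A $ i $ j))"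
  for A :: "'b ^ 'm ^ 'm"
proof -
  have "\<phi> (of_int (sign q)) = of_int (sign q)" for q :: "'m \<Rightarrow> 'm"
    by (simp add: sign_def hom_one hom_uminus)
  then show ?thesis
    by (simp add: det_def hom_sum hom_mult hom_prod)
qed

lemma det_nz_iff_columns: "det A \<noteq> 0 \<longleftrightarrow> vec.span (range (\<lambda>j. column j A)) = UNIV"
  for A :: "'l::field ^ 'm ^ 'm"
proof -
  have "det A \<noteq> 0 \<longleftrightarrow> (\<exists>B. A ** B = mat 1)"
    by (metis invertible_det_nz invertible_right_inverse)
  also have "\<dots> \<longleftrightarrow> vec.span (columns A) = UNIV"
    by (rule matrix_right_invertible_span_columns)
  also have "columns A = range (\<lambda>j. column j A)" by (auto simp: columns_def)
  finally show ?thesis .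
qed

definition column_choice_matrix :: "('a \<Rightarrow> 'r ^ 'm) \<Rightarrow> ('m \<Rightarrow> 'a + 'm) \<Rightarrow> 'r::comm_ring_1 ^ 'm ^ 'm"
  where "column_choice_matrix u c = (\<chi> i j. (case c j of Inl a \<Rightarrow> u a | Inr k \<Rightarrow> axis k 1) $ i)"

lemma column_column_choice_matrix:
  "column j (column_choice_matrix u c) = (case c j of Inl a \<Rightarrow> u a | Inr k \<Rightarrow> axis k 1)"
  by (simp add: column_def column_choice_matrix_def vec_eq_iff)

text \<open>
  A family has rank greater than \<open>h\<close> iff more than \<open>h\<close> of its members can be completed by unit
  vectors to a basis. Compared with minors of varying size this needs determinants of one size only.
\<close>

lemma rank_gt_iff_det:
  fixes u :: "'a \<Rightarrow> 'l::field ^ 'm::finite"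
  shows "h < vec.dim (u ` T) \<longleftrightarrow>
    (\<exists>c. (\<forall>j a. c j = Inl a \<longrightarrow> a \<in> T) \<and> h < card {j. isl (c j)} \<and> det (column_choice_matrix u c) \<noteq> 0)"
    (is "?L \<longleftrightarrow> (\<exists>c. ?R c)")
proof
  assume ?L
  obtain B where B: "B \<subseteq> u ` T" "vec.independent B" "card B = vec.dim (u ` T)"
    using vec.basis_exists[of "u ` T"] by metis
  let ?E = "range (\<lambda>k. axis k (1::'l)) :: ('l ^ 'm) set"
  have E: "cart_basis = ?E" by (auto simp: cart_basis_def)
  obtain B' where B': "B \<subseteq> B'" "B' \<subseteq> B \<union> ?E" "vec.independent B'" "B \<union> ?E \<subseteq> vec.span B'"
    using vec.maximal_independent_subset_extend[of B "B \<union> ?E"] B(2) by blast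
  have "vec.span ?E \<subseteq> vec.span B'"
    using B'(4) by (intro vec.span_minimal vec.subspace_span) auto
  moreover have "vec.span ?E = UNIV"
    unfolding E[symmetric] by (rule vec.span_Basis)
  ultimately have span: "vec.span B' = UNIV"
    by (simp add: top.extremum_unique)
  have "card B' = CARD('m)"
    using vec.dim_eq_card_independent[OF B'(3)] vec.dim_span[of B'] span vec_dim_card by metis
  then obtain e where e: "bij_betw e (UNIV :: 'm set) B'"
    using finite_same_card_bij[of "UNIV :: 'm set" B'] vec.finiteI_independent[OF B'(3)] by auto
  have "\<exists>x. (case x of Inl a \<Rightarrow> u a | Inr k \<Rightarrow> axis k 1) = e j \<and> (\<forall>a. x = Inl a \<longrightarrow> a \<in> T) \<and> (isl x \<longleftrightarrow> e j \<in> B)" for j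
  proof (cases "e j \<in> B")
    case True
    then obtain a where "a \<in> T" "u a = e j" using B(1) by auto
    then show ?thesis using True by (intro exI[of _ "Inl a"]) auto
  next
    case False
    then obtain k where "e j = axis k 1" using B'(2) e by (auto simp: bij_betw_def)
    then show ?thesis using False by (intro exI[of _ "Inr k"]) auto
  qed
  then obtain c where c: "\<And>j. (case c j of Inl a \<Rightarrow> u a | Inr k \<Rightarrow> axis k 1) = e j"
    "\<And>j a. c j = Inl a \<Longrightarrow> a \<in> T" "\<And>j. isl (c j) \<longleftrightarrow> e j \<in> B" by metis
  have "det (column_choice_matrix u c) \<noteq> 0"
    using e span unfolding det_nz_iff_columns column_column_choice_matrix c(1) by (simp add: bij_betw_def)
  moreover have "e ` {j. isl (c j)} = B" using B'(1) e by (auto simp: c(3) bij_betw_def)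
  then have "card {j. isl (c j)} = card B"
    using e by (metis bij_betw_def card_image inj_on_subset subset_UNIV)
  ultimately show "\<exists>c. ?R c" using \<open>?L\<close> B(3) c(2) by (intro exI[of _ c]) auto
next
  assume "\<exists>c. ?R c"
  then obtain c where c: "\<And>j a. c j = Inl a \<Longrightarrow> a \<in> T" "h < card {j. isl (c j)}"
    "det (column_choice_matrix u c) \<noteq> 0" by blast
  define e where "e j = (case c j of Inl a \<Rightarrow> u a | Inr k \<Rightarrow> axis k 1)" for j
  have span: "vec.span (range e) = UNIV"
    using c(3) unfolding det_nz_iff_columns column_column_choice_matrix e_def[abs_def] .
  then have dim: "vec.dim (range e) = CARD('m)"
    using vec.dim_span[of "range e"] vec_dim_card by metis
  then have "CARD('m) \<le> card (range e)"
    using vec.dim_le_card'[of "range e"] by simp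
  then have "card (range e) = CARD('m)"
    using card_image_le[of "UNIV :: 'm set" e] by simp
  then have "inj e" by (simp add: eq_card_imp_inj_on)
  have ind: "vec.independent (range e)"
    by (rule vec.card_le_dim_spanning[of _ UNIV])
      (use span \<open>card (range e) = CARD('m)\<close> in \<open>auto simp: card_cart_basis\<close>)
  have "h < card (e ` {j. isl (c j)})"
    using c(2) \<open>inj e\<close> by (simp add: card_image inj_on_subset)
  also have "\<dots> \<le> vec.dim (u ` T)"
  proof (rule vec.independent_card_le_dim)
    show "e ` {j. isl (c j)} \<subseteq> u ` T"
      using c(1) by (auto simp: e_def isl_def)
    show "vec.independent (e ` {j. isl (c j)})"
      by (rule vec.independent_mono[OF ind]) auto
  qed
  finally show ?L .
qed

lemma terms_upto_eq_words:
  "{s :: 'n::finite pterm. tdeg s \<le> i} = (\<lambda>l. sum_list (map var_term l)) ` {l. length l \<le> i}"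
proof -
  have "tdeg (sum_list (map var_term l)) = length l" for l :: "'n list"
    by (induction l) (auto simp: tdeg_add)
  moreover have "\<exists>l. s = sum_list (map var_term l)" for s :: "'n pterm"
  proof (induction s rule: term_induct)
    case zero
    show ?case by (intro exI[of _ "[]"]) simp
  next
    case (var r s)
    then obtain l where "s = sum_list (map var_term l)" by blast
    then show ?case by (intro exI[of _ "r # l"]) simp
  qed
  ultimately show ?thesis by (auto simp: image_iff) metis
qed

context border_basis
begin

text \<open>
  The generic multiplication matrices do not commute, so generic coordinate vectors are attached
  to words rather than to terms.
\<close>

fun word_vec :: "'n list \<Rightarrow> ('m \<times> 'v, 'k::field) mpoly ^ 'm" where
  "word_vec [] = axis i0 1"
| "word_vec (r # l) = gen_mult_matrix t b r *v word_vec l"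

definition rank_equations :: "(nat \<Rightarrow> nat) \<Rightarrow> ('m \<times> 'v, 'k::field) mpoly set"
  where "rank_equations H = {det (column_choice_matrix word_vec c) | c i.
    (\<forall>j l. c j = Inl l \<longrightarrow> length l \<le> i) \<and> H i < card {j. isl (c j)}}"

lemma eval_gen_mult_matrix:
  "(\<chi> i j. eval_ac \<Gamma> (gen_mult_matrix t b r $ i $ j)) = mult_matrix t b \<Gamma> r"
  for \<Gamma> :: "'m \<times> 'v \<Rightarrow> 'k::field alg_closure"
proof -
  interpret unital_hom "eval_ac \<Gamma>" by (rule unital_hom_eval_ac)
  show ?thesis by (simp add: vec_eq_iff gen_mult_matrix_def mult_matrix_def hom_one hom_zero)
qed

text \<open>
  The entries of the generic commutators lie in the ideal of the scheme, and evaluation at the point turns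
  them into the entries of the commutators at the point.
\<close>

lemma geometric_point_commutes:
  fixes \<Gamma> :: "'m \<times> 'v \<Rightarrow> 'k::field alg_closure"
  assumes "\<Gamma> \<in> geometric_points t b"
  shows "border_basis_point t b \<Gamma>"
proof
  fix r s
  interpret unital_hom "eval_ac \<Gamma>" by (rule unital_hom_eval_ac)
  let ?A = "\<lambda>r. gen_mult_matrix t b r :: ('m \<times> 'v, 'k) mpoly ^ 'm ^ 'm"
  have "eval_ac \<Gamma> ((?A r ** ?A s - ?A s ** ?A r) $ i $ j) = 0" for i j
  proof -
    have "(?A r ** ?A s - ?A s ** ?A r) $ i $ j \<in> border_basis_ideal t b"
      unfolding border_basis_ideal_def
      by (rule set_mp[OF ring.genideal_self[OF ring_from_type_algebra]]) auto
    then show ?thesis using assms by (auto simp: geometric_points_def)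
  qed
  then show "mult_matrix t b \<Gamma> r ** mult_matrix t b \<Gamma> s = mult_matrix t b \<Gamma> s ** mult_matrix t b \<Gamma> r"
    by (simp add: vec_eq_iff matrix_matrix_mult_def hom_diff hom_sum hom_mult flip: eval_gen_mult_matrix)
qed

text \<open>
  Semicontinuity: each value of the affine Hilbert function is the rank of vectors whose entries are polynomials
  in the coordinates of the point, and an upper bound on a rank is a closed condition.
\<close>

lemma affine_HF_le_iff_rank_equations:
  fixes \<Gamma> :: "'m \<times> 'v \<Rightarrow> 'k::field alg_closure"
  assumes "\<Gamma> \<in> geometric_points t b"
  shows "affine_HF (border_basis_fiber_ideal t b \<Gamma>) \<le> H \<longleftrightarrow> (\<forall>f\<in>rank_equations H. eval_ac \<Gamma> f = 0)"
proof -
  interpret border_basis_point t b \<Gamma> by (rule geometric_point_commutes[OF assms])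
  interpret ev: unital_hom "eval_ac \<Gamma>" by (rule unital_hom_eval_ac)
  define u where "u l = (\<chi> i. eval_ac \<Gamma> (word_vec l $ i))" for l
  have u: "term_vec (sum_list (map var_term l)) = u l" for l
  proof (induction l)
    case Nil
    show ?case by (simp add: u_def term_vec_zero vec_eq_iff axis_def ev.hom_one ev.hom_zero)
  next
    case (Cons r l)
    then show ?case
      by (simp add: u_def term_vec_var vec_eq_iff matrix_vector_mult_def ev.hom_sum ev.hom_mult
          flip: eval_gen_mult_matrix)
  qed
  have "affine_HF (border_basis_fiber_ideal t b \<Gamma>) i = vec.dim (u ` {l. length l \<le> i})" for i
    unfolding affine_HF_fiber terms_upto_eq_words image_image u ..
  moreover have "det (column_choice_matrix u c) = eval_ac \<Gamma> (det (column_choice_matrix word_vec c))" for c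
    unfolding ev.hom_det
    by (rule arg_cong[of _ _ det])
      (simp add: vec_eq_iff column_choice_matrix_def u_def axis_def ev.hom_one ev.hom_zero split: sum.split)
  ultimately have "H i < affine_HF (border_basis_fiber_ideal t b \<Gamma>) i \<longleftrightarrow>
      (\<exists>c. (\<forall>j l. c j = Inl l \<longrightarrow> length l \<le> i) \<and> H i < card {j. isl (c j)}
        \<and> eval_ac \<Gamma> (det (column_choice_matrix word_vec c)) \<noteq> 0)" for i
    by (simp add: rank_gt_iff_det)
  then show ?thesis
    unfolding le_fun_def not_less[symmetric] rank_equations_def by blast
qed

end

section \<open>Closures in the border basis scheme\<close>

lemma primeideal_point_ideal: "primeideal (point_ideal \<Gamma>) mpoly_ring"
  for \<Gamma> :: "'x::finite \<Rightarrow> 'k::field alg_closure"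
proof (rule primeidealI)
  interpret unital_hom "eval_ac \<Gamma>" by (rule unital_hom_eval_ac)
  show "ideal (point_ideal \<Gamma>) mpoly_ring"
    by (rule ideal_mpoly_ringI) (auto simp: point_ideal_def hom_zero hom_add hom_mult)
  show "cring (mpoly_ring :: ('x, 'k) mpoly ring)" by (rule cring_from_type_algebra)
  have "1 \<notin> point_ideal \<Gamma>" by (simp add: point_ideal_def hom_one)
  then show "carrier mpoly_ring \<noteq> point_ideal \<Gamma>" by auto
qed (auto simp: point_ideal_def unital_hom.hom_mult[OF unital_hom_eval_ac])

lemma topspace_zariski: "topspace (zariski :: ('x, 'k::field) mpoly set topology) = prime_spec"
proof -
  have "zero_locus {1} = ({} :: ('x, 'k) mpoly set set)"
    using primeideal_mpoly_ringD(2) by (auto simp: zero_locus_def prime_spec_def)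
  then have "openin zariski (prime_spec :: ('x, 'k) mpoly set set)"
    unfolding openin_zariski by (intro exI[of _ "{1}"]) simp
  then have "(prime_spec :: ('x, 'k) mpoly set set) \<subseteq> topspace zariski" by (rule openin_subset)
  moreover have "topspace zariski \<subseteq> (prime_spec :: ('x, 'k) mpoly set set)"
    using openin_topspace[of zariski] unfolding openin_zariski by blast
  ultimately show ?thesis by blast
qed

lemma closedin_zariski_zero_locus: "closedin zariski (zero_locus E)"
  unfolding closedin_def topspace_zariski openin_zariski
  by (auto simp: zero_locus_def)

lemma zero_locus_Un: "zero_locus (E \<union> F) = zero_locus E \<inter> zero_locus F"
  by (auto simp: zero_locus_def)

text \<open>
  This is where the Nullstellensatz enters: a prime at which the equations \<open>E\<close> hold is a limit of
  geometric points at which they hold.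
\<close>

lemma closure_of_geometric_points:
  fixes t :: "'m::finite \<Rightarrow> 'n pterm" and b :: "'v::finite \<Rightarrow> 'n pterm"
  shows "border_basis_scheme TYPE('k::field) t b closure_of
      (point_ideal ` {\<Gamma> \<in> geometric_points t b. \<forall>f\<in>E. eval_ac \<Gamma> f = 0})
    = zero_locus (border_basis_ideal t b \<union> E)" (is "?T closure_of ?S = ?Z")
proof
  have "?S \<subseteq> ?Z"
    using primeideal_point_ideal
    by (auto simp: zero_locus_def prime_spec_def geometric_points_def point_ideal_def)
  moreover have "closedin ?T ?Z"
    unfolding border_basis_scheme_def zero_locus_Un closedin_subtopology
    by (intro exI[of _ "zero_locus E"]) (auto intro: closedin_zariski_zero_locus)
  ultimately show "?T closure_of ?S \<subseteq> ?Z" by (rule closure_of_minimal)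
  show "?Z \<subseteq> ?T closure_of ?S"
  proof
    fix p assume p: "p \<in> ?Z"
    show "p \<in> ?T closure_of ?S"
      unfolding in_closure_of
    proof (intro conjI allI impI)
      show "p \<in> topspace ?T"
        using p by (auto simp: border_basis_scheme_def topspace_zariski zero_locus_def)
      fix U assume U: "p \<in> U \<and> openin ?T U"
      then obtain F where F: "U = (prime_spec - zero_locus F) \<inter> zero_locus (border_basis_ideal t b)"
        unfolding border_basis_scheme_def openin_subtopology openin_zariski by blast
      with U p obtain f where f: "f \<in> F" "f \<notin> p" by (auto simp: zero_locus_def)
      have "primeideal p mpoly_ring" using p by (auto simp: zero_locus_def prime_spec_def)
      then obtain \<Gamma> where \<Gamma>: "p \<subseteq> point_ideal \<Gamma>" "f \<notin> point_ideal \<Gamma>"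
        using nullstellensatz f(2) by blast
      have "border_basis_ideal t b \<union> E \<subseteq> point_ideal \<Gamma>"
        using p \<Gamma>(1) by (auto simp: zero_locus_def)
      then have "point_ideal \<Gamma> \<in> ?S" "point_ideal \<Gamma> \<in> U"
        unfolding F using f(1) \<Gamma>(2) primeideal_point_ideal[of \<Gamma>]
        by (auto simp: geometric_points_def point_ideal_def zero_locus_def prime_spec_def)
      then show "\<exists>y. y \<in> ?S \<and> y \<in> U" by blast
    qed
  qed
qed

section \<open>The Hilbert stratification\<close>

context border_basis
begin

abbreviation fiber_HF :: "('m \<times> 'v \<Rightarrow> 'k::field alg_closure) \<Rightarrow> nat \<Rightarrow> nat"
  where "fiber_HF \<Gamma> \<equiv> affine_HF (border_basis_fiber_ideal t b \<Gamma>)"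

text \<open>
  Only functions in the index set occur at geometric points. The bounds are read off from the unit
  vectors and from the number of terms, and admissibility over \<open>K\<close> comes from the standard terms.
\<close>

lemma fiber_HF_in_stratum_HFs:
  fixes \<Gamma> :: "'m \<times> 'v \<Rightarrow> 'k::field alg_closure"
  assumes "\<Gamma> \<in> geometric_points t b"
  shows "fiber_HF \<Gamma> \<in> stratum_HFs TYPE('k) t"
proof -
  interpret border_basis_point t b \<Gamma> by (rule geometric_point_commutes[OF assms])
  show ?thesis
    unfolding stratum_HFs_def
    using admissible_affine_HF_fiber affine_HF_fiber_lower affine_HF_fiber_upper by blast
qed

text \<open>
  Beyond the largest degree in the order ideal both bounds equal the length, so a function in the
  index set is determined by finitely many bounded values.
\<close>

lemma finite_stratum_HFs: "finite (stratum_HFs TYPE('k::field) t)"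
proof -
  define N where "N = Max (range (\<lambda>j. tdeg (t j)))"
  have N: "tdeg (t j) \<le> N" for j unfolding N_def by (rule Max_ge) auto
  have "H i = CARD('m)" if H: "H \<in> stratum_HFs TYPE('k) t" and "i > N" for H i
  proof (rule antisym)
    show "H i \<le> CARD('m)"
      using H by (auto simp: stratum_HFs_def le_fun_def max_HF_def)
    have "{s \<in> range t. tdeg s \<le> i} = range t"
      using N \<open>i > N\<close> by (auto intro: order_trans less_imp_le)
    then have "order_ideal_HF (range t) i = CARD('m)"
      using inj_t by (simp add: order_ideal_HF_def card_image)
    moreover have "order_ideal_HF (range t) i \<le> H i"
      using H by (auto simp: stratum_HFs_def le_fun_def)
    ultimately show "CARD('m) \<le> H i" by simp
  qed
  moreover have "H i \<le> CARD('m)" if "H \<in> stratum_HFs TYPE('k) t" for H i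
    using that by (auto simp: stratum_HFs_def le_fun_def max_HF_def)
  ultimately have "stratum_HFs TYPE('k) t \<subseteq>
      {H. \<forall>i. (i \<in> {..N} \<longrightarrow> H i \<in> {..CARD('m)}) \<and> (i \<notin> {..N} \<longrightarrow> H i = CARD('m))}"
    by (auto simp: not_le)
  then show ?thesis
    by (rule finite_subset) (intro finite_set_of_finite_funs finite_atMost)
qed

abbreviation scheme :: "'k::field itself \<Rightarrow> ('m \<times> 'v, 'k) mpoly set topology"
  where "scheme K \<equiv> border_basis_scheme K t b"

definition points_at_most :: "(nat \<Rightarrow> nat) \<Rightarrow> ('m \<times> 'v, 'k::field) mpoly set set"
  where "points_at_most H = point_ideal ` {\<Gamma> \<in> geometric_points t b. fiber_HF \<Gamma> \<le> H}"

lemma closed_stratum_eq_closure: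
  "closed_stratum TYPE('k::field) t b H = scheme TYPE('k) closure_of points_at_most H"
  by (simp add: closed_stratum_def points_at_most_def)

lemma closed_stratum_eq_zero_locus:
  "closed_stratum TYPE('k::field) t b H = zero_locus (border_basis_ideal t b \<union> rank_equations H)"
proof -
  have "{\<Gamma> \<in> geometric_points t b. fiber_HF \<Gamma> \<le> H}
      = {\<Gamma> \<in> geometric_points t b. \<forall>f\<in>rank_equations H. eval_ac \<Gamma> f = (0 :: 'k alg_closure)}"
    using affine_HF_le_iff_rank_equations by blast
  then show ?thesis
    unfolding closed_stratum_def closure_of_geometric_points[symmetric] by (rule arg_cong)
qed

lemma closure_Union_points_at_most:
  assumes "finite \<H>"
  shows "scheme TYPE('k::field) closure_of \<Union> (points_at_most ` \<H>)
    = (\<Union>H\<in>\<H>. closed_stratum TYPE('k) t b H)"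
  using closure_of_Union[of "points_at_most ` \<H>" "scheme TYPE('k)"] assms
  by (simp add: closed_stratum_eq_closure)

text \<open>The strict part is a finite union of smaller closed strata, since only finitely many Hilbert functions occur.\<close>

lemma closure_strict_eq:
  "scheme TYPE('k::field) closure_of
      (point_ideal ` {\<Gamma> \<in> geometric_points t b. fiber_HF \<Gamma> < H})
    = (\<Union>H'\<in>{H' \<in> stratum_HFs TYPE('k) t. H' < H}. closed_stratum TYPE('k) t b H')"
proof -
  let ?\<H> = "{H' \<in> stratum_HFs TYPE('k) t. H' < H}"
  have "{\<Gamma> :: 'm \<times> 'v \<Rightarrow> 'k alg_closure. \<Gamma> \<in> geometric_points t b \<and> fiber_HF \<Gamma> < H}
      = (\<Union>H'\<in>?\<H>. {\<Gamma> \<in> geometric_points t b. fiber_HF \<Gamma> \<le> H'})"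
    using fiber_HF_in_stratum_HFs by (auto intro: order.strict_trans1)
  then have "point_ideal ` {\<Gamma> :: 'm \<times> 'v \<Rightarrow> 'k alg_closure. \<Gamma> \<in> geometric_points t b \<and> fiber_HF \<Gamma> < H}
      = \<Union> (points_at_most ` ?\<H>)"
    by (auto simp: points_at_most_def)
  then show ?thesis
    using closure_Union_points_at_most[of ?\<H>] finite_stratum_HFs[where 'k = 'k] by simp
qed

lemma hilbert_stratum_eq:
  "hilbert_stratum TYPE('k::field) t b H = closed_stratum TYPE('k) t b H
    - (\<Union>H'\<in>{H' \<in> stratum_HFs TYPE('k) t. H' < H}. closed_stratum TYPE('k) t b H')"
  unfolding hilbert_stratum_def closure_strict_eq ..

lemma openin_hilbert_stratum:
  "openin (subtopology (scheme TYPE('k::field)) (closed_stratum TYPE('k) t b H)) (hilbert_stratum TYPE('k) t b H)"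
  and locally_closedin_hilbert_stratum:
  "locally_closedin (scheme TYPE('k)) (hilbert_stratum TYPE('k) t b H)"
proof -
  let ?C = "scheme TYPE('k) closure_of (point_ideal ` {\<Gamma> \<in> geometric_points t b. fiber_HF \<Gamma> < H})"
  have "closed_stratum TYPE('k) t b H \<subseteq> topspace (scheme TYPE('k))"
    unfolding closed_stratum_def by (rule closure_of_subset_topspace)
  then have eq: "hilbert_stratum TYPE('k) t b H = (topspace (scheme TYPE('k)) - ?C) \<inter> closed_stratum TYPE('k) t b H"
    unfolding hilbert_stratum_def by blast
  have op: "openin (scheme TYPE('k)) (topspace (scheme TYPE('k)) - ?C)"
    by (intro openin_diff openin_topspace closedin_closure_of)
  show "openin (subtopology (scheme TYPE('k)) (closed_stratum TYPE('k) t b H)) (hilbert_stratum TYPE('k) t b H)"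
    unfolding eq openin_subtopology using op by blast
  have "closedin (scheme TYPE('k)) (closed_stratum TYPE('k) t b H)"
    unfolding closed_stratum_def by (rule closedin_closure_of)
  then show "locally_closedin (scheme TYPE('k)) (hilbert_stratum TYPE('k) t b H)"
    unfolding eq locally_closedin_def using op by blast
qed

text \<open>
  Every point lies in some closed stratum, since the geometric points are dense and only finitely many Hilbert functions occur.
  It belongs to the stratum of a minimal such function.
\<close>

lemma hilbert_strata_cover:
  "topspace (scheme TYPE('k::field)) = (\<Union>H\<in>stratum_HFs TYPE('k) t. hilbert_stratum TYPE('k) t b H)"
proof
  show "(\<Union>H\<in>stratum_HFs TYPE('k) t. hilbert_stratum TYPE('k) t b H) \<subseteq> topspace (scheme TYPE('k))"
    unfolding hilbert_stratum_def closed_stratum_def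
    by (intro UN_least order.trans[OF Diff_subset] closure_of_subset_topspace)
  show "topspace (scheme TYPE('k)) \<subseteq> (\<Union>H\<in>stratum_HFs TYPE('k) t. hilbert_stratum TYPE('k) t b H)"
  proof
    fix p assume p: "p \<in> topspace (scheme TYPE('k))"
    have "topspace (scheme TYPE('k)) = zero_locus (border_basis_ideal t b \<union> {})"
      by (auto simp: border_basis_scheme_def topspace_zariski zero_locus_def)
    also have "\<dots> = scheme TYPE('k) closure_of (point_ideal ` geometric_points t b)"
      using closure_of_geometric_points[where E = "{}" and 'k = 'k and t = t and b = b] by simp
    also have "(point_ideal ` geometric_points t b :: ('m \<times> 'v, 'k) mpoly set set)
        = \<Union> (points_at_most ` stratum_HFs TYPE('k) t)"
      using fiber_HF_in_stratum_HFs by (auto simp: points_at_most_def)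
    also have "scheme TYPE('k) closure_of \<dots> = (\<Union>H\<in>stratum_HFs TYPE('k) t. closed_stratum TYPE('k) t b H)"
      by (rule closure_Union_points_at_most[OF finite_stratum_HFs])
    finally have "\<exists>H. H \<in> {H \<in> stratum_HFs TYPE('k) t. p \<in> closed_stratum TYPE('k) t b H}"
      using p by blast
    moreover have "finite {H \<in> stratum_HFs TYPE('k) t. p \<in> closed_stratum TYPE('k) t b H}"
      using finite_stratum_HFs[where 'k = 'k] by auto
    ultimately obtain H where "H \<in> stratum_HFs TYPE('k) t" "p \<in> closed_stratum TYPE('k) t b H"
      and min: "\<And>H'. H' \<in> stratum_HFs TYPE('k) t \<Longrightarrow> p \<in> closed_stratum TYPE('k) t b H' \<Longrightarrow> H' \<le> H \<Longrightarrow> H' = H"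
      using finite_has_minimal[of "{H \<in> stratum_HFs TYPE('k) t. p \<in> closed_stratum TYPE('k) t b H}"]
      by (metis (mono_tags, lifting) empty_iff mem_Collect_eq)
    then have "p \<in> hilbert_stratum TYPE('k) t b H"
      unfolding hilbert_stratum_eq by (auto dest: less_imp_le)
    then show "p \<in> (\<Union>H\<in>stratum_HFs TYPE('k) t. hilbert_stratum TYPE('k) t b H)"
      using \<open>H \<in> stratum_HFs TYPE('k) t\<close> by blast
  qed
qed

text \<open>
  A point in both closed strata satisfies both systems of rank equations, hence is a limit of
  geometric points at which \<open>HF \<le> H\<close> and \<open>HF \<le> H'\<close>. The latter excludes \<open>HF = H\<close>, as
  \<open>H \<le> H'\<close> fails, so the point lies in the closure that was removed from the stratum of \<open>H\<close>.
\<close>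

lemma hilbert_strata_disjoint:
  assumes "\<not> H \<le> H'"
  shows "hilbert_stratum TYPE('k::field) t b H \<inter> hilbert_stratum TYPE('k) t b H' = {}"
proof -
  have "closed_stratum TYPE('k) t b H \<inter> closed_stratum TYPE('k) t b H'
      = zero_locus (border_basis_ideal t b \<union> (rank_equations H \<union> rank_equations H'))"
    by (auto simp: closed_stratum_eq_zero_locus zero_locus_Un)
  also have "\<dots> = scheme TYPE('k) closure_of (point_ideal ` {\<Gamma> \<in> geometric_points t b.
      \<forall>f\<in>rank_equations H \<union> rank_equations H'. eval_ac \<Gamma> f = 0})"
    by (rule closure_of_geometric_points[symmetric])
  also have "\<dots> \<subseteq> scheme TYPE('k) closure_of (point_ideal ` {\<Gamma> \<in> geometric_points t b. fiber_HF \<Gamma> < H})"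
  proof (intro closure_of_mono image_mono subsetI)
    fix \<Gamma> :: "'m \<times> 'v \<Rightarrow> 'k alg_closure"
    assume *: "\<Gamma> \<in> {\<Gamma> \<in> geometric_points t b. \<forall>f\<in>rank_equations H \<union> rank_equations H'. eval_ac \<Gamma> f = 0}"
    then have \<Gamma>: "\<Gamma> \<in> geometric_points t b" by simp
    have "fiber_HF \<Gamma> \<le> H" "fiber_HF \<Gamma> \<le> H'"
      using * unfolding affine_HF_le_iff_rank_equations[OF \<Gamma>] by auto
    then show "\<Gamma> \<in> {\<Gamma> \<in> geometric_points t b. fiber_HF \<Gamma> < H}"
      using \<Gamma> assms by (auto simp: order.strict_iff_order)
  qed
  finally show ?thesis unfolding hilbert_stratum_def by blast
qed

end

theorem corollary9p14:
  fixes t :: "'m::{finite,linorder} \<Rightarrow> 'n::finite pterm"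
    and b :: "'v::finite \<Rightarrow> 'n pterm"
  assumes "inj t"
    and "order_ideal (range t)"
    and "mono (\<lambda>i. tdeg (t i))"
    and "bij_betw b UNIV (border (range t))"
  shows "(\<forall>H. admissible TYPE('k::field) TYPE('n) CARD('m) H
              \<and> order_ideal_HF (range t) \<le> H \<and> H \<le> max_HF TYPE('n) CARD('m) \<longrightarrow>
            openin (subtopology (border_basis_scheme TYPE('k) t b) (closed_stratum TYPE('k) t b H))
                   (hilbert_stratum TYPE('k) t b H)
            \<and> locally_closedin (border_basis_scheme TYPE('k) t b) (hilbert_stratum TYPE('k) t b H))
       \<and> topspace (border_basis_scheme TYPE('k) t b)
           = (\<Union>H\<in>stratum_HFs TYPE('k) t. hilbert_stratum TYPE('k) t b H)
       \<and> disjoint_family_on (hilbert_stratum TYPE('k) t b) (stratum_HFs TYPE('k) t)"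
proof -
  interpret border_basis t b
    by (rule border_basis.intro) (rule assms)+
  have "disjoint_family_on (hilbert_stratum TYPE('k) t b) (stratum_HFs TYPE('k) t)"
    unfolding disjoint_family_on_def
    using hilbert_strata_disjoint by (metis Int_commute antisym)
  then show ?thesis
    using openin_hilbert_stratum locally_closedin_hilbert_stratum hilbert_strata_cover by blast
qed

end
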